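(* Let $A$ be a commutative semiring and let $X=\operatorname{Spec} A$ with its Zariski topology. The three sheaves of semirings $\mathcal{O}^{\mathrm{A}}_X$, $\mathcal{O}^{\mathrm{B}}_X$ and $\mathcal{O}^{\mathrm{C}}_X$ on $X$ constructed in the context are isomorphic. In particular, writing $\mathcal{O}_X$ for this sheaf (which is unique up to isomorphism): (1) for any element $a\in A$, the natural morphism $A_a\to\mathcal{O}_X(D(a))$ is an isomorphism; (2) the semiring of global sections of $\mathcal{O}_X$ is $\mathcal{O}_X(X)\cong A$; (3) for any $\mathfrak{p}\in X$, the stalk $\mathcal{O}_{X,\mathfrak{p}}$ of $\mathcal{O}_X$ at $\mathfrak{p}$ is isomorphic to the local semiring $A_{\mathfrak{p}}$.
   Context: A (commutative) semiring is a set $A$ with operations $+,\cdot$ such that $(A,+,0_A)$ and $(A,\cdot,1_A)$ are commutative monoids, $\cdot$ distributes over $+$, and $a\cdot 0_A=0_A$ for all $a$. Homomorphisms preserve $+,\cdot,0,1$. An ideal is a subset containing $0_A$, closed under addition and under multiplication by $A$; an ideal $\mathfrak{p}\neq A$ is prime if $ab\in\mathfrak{p}$ implies $a\in\mathfrak{p}$ or $b\in\mathfrak{p}$. For a multiplicative submonoid $S\subseteq A$, $S^{-1}A=\{a/s\mid a\in A,s\in S\}$, where $a_1/s_1=a_2/s_2$ iff there is $u\in S$ with $a_1s_2u=a_2s_1u$; it is a semiring with the usual operations on fractions. Write $A_a$ for the localization at $\{a^n\mid n\in\mathbb{N}\}$ and $A_{\mathfrak{p}}=(A\setminus\mathfrak{p})^{-1}A$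 for $\mathfrak{p}$ prime. $\operatorname{Spec}A$ is the set of prime ideals of $A$; its Zariski topology has as closed sets the sets $V(S)=\{\mathfrak{p}\in\operatorname{Spec} A\mid S\subseteq\mathfrak{p}\}$, $S\subseteq A$. For $a\in A$ put $D(a)=\{\mathfrak{p}\in\operatorname{Spec} A\mid a\notin\mathfrak{p}\}$; these principal open sets form a basis of the topology and $D(a)\cap D(b)=D(ab)$. For an open $U\subseteq X$ let $S_U=\{b\in A\mid D(b)\supseteq U\}$, a multiplicative submonoid of $A$, and $S_a=S_{D(a)}$. Let $\mathcal{F}$ be the presheaf of semirings $\mathcal{F}(U)=S_U^{-1}A$, with restriction maps the natural localization maps. Construction A: $\mathcal{O}^{\mathrm{A}}_X=\mathcal{F}^{\#}$ is the sheafification of $\mathcal{F}$. Construction B: the restriction of $\mathcal{F}$ to the basis of principal open sets, $D(a)\mapsto S_a^{-1}A$, is a sheaf on this basis, and $\mathcal{O}^{\mathrm{B}}_X$ is its unique extension to a sheaf on $X$; explicitly, $$\mathcal{O}^{\mathrm{B}}_X(U)=\operatorname{Eq}\Big(\prod_{i\in I}\mathcal{F}(D(a_i))\rightrightarrows\prod_{i,j\in I}\mathcal{F}(D(a_ia_j))\Big)$$ for any covering $U=\bigcup_{i\in I}D(a_i)$ (independent of the covering), where $\operatorname{Eq}$ is the equalizer of the two restriction maps. Construction C: $\mathcal{O}^{\mathrm{C}}_X(U)$ is the semiring (with pointwise operations) of functions $s\colon U\to\coprod_{\mathfrak{p}\in U}A_{\mathfrak{p}}$ such that $s(\mathfrak{p})\in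 A_{\mathfrak{p}}$ for every $\mathfrak{p}\in U$ and such that for each $\mathfrak{p}\in U$ there are an open neighbourhood $V\subseteq U$ of $\mathfrak{p}$ and $a,f\in A$ with $f\notin\mathfrak{q}$ and $s(\mathfrak{q})=a/f$ in $A_{\mathfrak{q}}$ for all $\mathfrak{q}\in V$; restriction maps are restrictions of functions. *)

theory Defs
  imports "HOL-Algebra.Ring" "HOL-Analysis.Abstract_Topology"
begin

section \<open>Commutative semirings\<close>

locale csemiring = semiring R + comm_monoid R for R (structure)

text \<open>\<open>ring_hom\<close> does not demand preservation of zero, which is not automatic for semirings.\<close>

definition semiring_hom :: "('a, 'm) ring_scheme \<Rightarrow> ('b, 'n) ring_scheme \<Rightarrow> ('a \<Rightarrow> 'b) set" where
  "semiring_hom R S = {h \<in> ring_hom R S. h \<zero>\<^bsub>R\<^esub> = \<zero>\<^bsub>S\<^esub>}"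

definition semiring_iso :: "('a, 'm) ring_scheme \<Rightarrow> ('b, 'n) ring_scheme \<Rightarrow> ('a \<Rightarrow> 'b) set" where
  "semiring_iso R S = {h \<in> semiring_hom R S. bij_betw h (carrier R) (carrier S)}"

definition semiring_isomorphic :: "('a, 'm) ring_scheme \<Rightarrow> ('b, 'n) ring_scheme \<Rightarrow> bool" where
  "semiring_isomorphic R S \<longleftrightarrow> (\<exists>h. h \<in> semiring_iso R S)"

text \<open>The library's ideals and prime ideals presuppose a ring.\<close>

definition semiring_ideal :: "('a, 'm) ring_scheme \<Rightarrow> 'a set \<Rightarrow> bool" where
  "semiring_ideal R I \<longleftrightarrow> I \<subseteq> carrier R \<and> \<zero>\<^bsub>R\<^esub> \<in> I \<and>
     (\<forall>x\<in>I. \<forall>y\<in>I. x \<oplus>\<^bsub>R\<^esub> y \<in> I) \<and> (\<forall>a\<in>carrier R. \<forall>x\<in>I. a \<otimes>\<^bsub>R\<^esub> x \<in> I)"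

definition semiring_prime :: "('a, 'm) ring_scheme \<Rightarrow> 'a set \<Rightarrow> bool" where
  "semiring_prime R P \<longleftrightarrow> semiring_ideal R P \<and> P \<noteq> carrier R \<and>
     (\<forall>a\<in>carrier R. \<forall>b\<in>carrier R. a \<otimes>\<^bsub>R\<^esub> b \<in> P \<longrightarrow> a \<in> P \<or> b \<in> P)"

definition semiring_maximal :: "('a, 'm) ring_scheme \<Rightarrow> 'a set \<Rightarrow> bool" where
  "semiring_maximal R M \<longleftrightarrow> semiring_ideal R M \<and> M \<noteq> carrier R \<and>
     (\<forall>J. semiring_ideal R J \<and> M \<subseteq> J \<longrightarrow> J = M \<or> J = carrier R)"

definition local_semiring :: "('a, 'm) ring_scheme \<Rightarrow> bool" where
  "local_semiring R \<longleftrightarrow> csemiring R \<and> (\<exists>!M. semiring_maximal R M)"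

definition product_semiring :: "'i set \<Rightarrow> ('i \<Rightarrow> 'b ring) \<Rightarrow> ('i \<Rightarrow> 'b) ring" where
  "product_semiring I R =
    \<lparr>carrier = (\<Pi>\<^sub>E i\<in>I. carrier (R i)),
     monoid.mult = (\<lambda>x y. \<lambda>i\<in>I. x i \<otimes>\<^bsub>R i\<^esub> y i),
     one = (\<lambda>i\<in>I. \<one>\<^bsub>R i\<^esub>),
     zero = (\<lambda>i\<in>I. \<zero>\<^bsub>R i\<^esub>),
     add = (\<lambda>x y. \<lambda>i\<in>I. x i \<oplus>\<^bsub>R i\<^esub> y i)\<rparr>"


section \<open>Localization\<close>

text \<open>The fraction \<open>a/s\<close> is the set of all pairs \<open>(b, t)\<close> with \<open>b/t = a/s\<close>. Operations on
  fractions are unions over all representatives; every member of such a union is the same class.\<close>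

definition fraction :: "('a, 'm) ring_scheme \<Rightarrow> 'a set \<Rightarrow> 'a \<Rightarrow> 'a \<Rightarrow> ('a \<times> 'a) set" where
  "fraction R S a s = {(b, t). b \<in> carrier R \<and> t \<in> S \<and>
     (\<exists>u\<in>S. a \<otimes>\<^bsub>R\<^esub> t \<otimes>\<^bsub>R\<^esub> u = b \<otimes>\<^bsub>R\<^esub> s \<otimes>\<^bsub>R\<^esub> u)}"

definition localization :: "('a, 'm) ring_scheme \<Rightarrow> 'a set \<Rightarrow> ('a \<times> 'a) set ring" where
  "localization R S =
    \<lparr>carrier = {fraction R S a s | a s. a \<in> carrier R \<and> s \<in> S},
     monoid.mult = (\<lambda>x y. \<Union>(a, s)\<in>x. \<Union>(b, t)\<in>y. fraction R S (a \<otimes>\<^bsub>R\<^esub> b) (s \<otimes>\<^bsub>R\<^esub> t)),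
     one = fraction R S \<one>\<^bsub>R\<^esub> \<one>\<^bsub>R\<^esub>,
     zero = fraction R S \<zero>\<^bsub>R\<^esub> \<one>\<^bsub>R\<^esub>,
     add = (\<lambda>x y. \<Union>(a, s)\<in>x. \<Union>(b, t)\<in>y.
              fraction R S ((a \<otimes>\<^bsub>R\<^esub> t) \<oplus>\<^bsub>R\<^esub> (b \<otimes>\<^bsub>R\<^esub> s)) (s \<otimes>\<^bsub>R\<^esub> t))\<rparr>"

text \<open>The natural map \<open>a/s \<mapsto> a/s\<close> from the localization at \<open>S\<close> to the one at \<open>T\<close>,
  for \<open>S \<subseteq> T\<close> (the source \<open>S\<close> is not needed to define it).\<close>

definition loc_map :: "('a, 'm) ring_scheme \<Rightarrow> 'a set \<Rightarrow> ('a \<times> 'a) set \<Rightarrow> ('a \<times> 'a) set" where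
  "loc_map R T x = (\<Union>(a, s)\<in>x. fraction R T a s)"

definition loc_elem :: "('a, 'm) ring_scheme \<Rightarrow> 'a \<Rightarrow> ('a \<times> 'a) set ring" where
  "loc_elem R a = localization R {a [^]\<^bsub>R\<^esub> n | n::nat. True}"

definition loc_prime :: "('a, 'm) ring_scheme \<Rightarrow> 'a set \<Rightarrow> ('a \<times> 'a) set ring" where
  "loc_prime R P = localization R (carrier R - P)"


section \<open>The spectrum\<close>

definition Spec :: "('a, 'm) ring_scheme \<Rightarrow> 'a set set" where
  "Spec R = {P. semiring_prime R P}"

definition zero_locus :: "('a, 'm) ring_scheme \<Rightarrow> 'a set \<Rightarrow> 'a set set" where
  "zero_locus R S = {P \<in> Spec R. S \<subseteq> P}"

definition zariski :: "('a, 'm) ring_scheme \<Rightarrow> 'a set topology" where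
  "zariski R = topology (\<lambda>U. \<exists>S\<subseteq>carrier R. U = Spec R - zero_locus R S)"

definition principal_open :: "('a, 'm) ring_scheme \<Rightarrow> 'a \<Rightarrow> 'a set set" where
  "principal_open R a = {P \<in> Spec R. a \<notin> P}"

lemma (in csemiring) openin_zariski:
  "openin (zariski R) U \<longleftrightarrow> (\<exists>S\<subseteq>carrier R. U = Spec R - zero_locus R S)"
proof -
  have "istopology (\<lambda>U. \<exists>S\<subseteq>carrier R. U = Spec R - zero_locus R S)"
    unfolding istopology_def
  proof (intro conjI allI impI)
    fix U V
    assume "\<exists>S\<subseteq>carrier R. U = Spec R - zero_locus R S"
      and "\<exists>S\<subseteq>carrier R. V = Spec R - zero_locus R S"
    then obtain S T where S: "S \<subseteq> carrier R" "U = Spec R - zero_locus R S"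
      and T: "T \<subseteq> carrier R" "V = Spec R - zero_locus R T" by blast
    let ?W = "{s \<otimes> t | s t. s \<in> S \<and> t \<in> T}"
    have *: "s \<otimes> t \<in> P \<longleftrightarrow> s \<in> P \<or> t \<in> P"
      if "P \<in> Spec R" "s \<in> S" "t \<in> T" for P s t
    proof -
      have st: "s \<in> carrier R" "t \<in> carrier R" using that S T by auto
      have prime: "semiring_prime R P" using that(1) by (simp add: Spec_def)
      have "s \<otimes> t \<in> P" if "t \<in> P"
        using prime st(1) that unfolding semiring_prime_def semiring_ideal_def by blast
      moreover have "s \<otimes> t \<in> P" if "s \<in> P"
        using prime st that m_comm[OF st]
        unfolding semiring_prime_def semiring_ideal_def by auto
      moreover have "s \<in> P \<or> t \<in> P" if "s \<otimes> t \<in> P"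
        using prime st that unfolding semiring_prime_def by blast
      ultimately show ?thesis by blast
    qed
    have "U \<inter> V = Spec R - zero_locus R ?W"
      unfolding S(2) T(2)
    proof (intro equalityI subsetI)
      fix P assume "P \<in> (Spec R - zero_locus R S) \<inter> (Spec R - zero_locus R T)"
      then obtain s t where "P \<in> Spec R" "s \<in> S" "s \<notin> P" "t \<in> T" "t \<notin> P"
        by (auto simp: zero_locus_def)
      then show "P \<in> Spec R - zero_locus R ?W"
        using *[of P s t] by (auto simp: zero_locus_def)
    next
      fix P assume "P \<in> Spec R - zero_locus R ?W"
      then obtain s t where "P \<in> Spec R" "s \<in> S" "t \<in> T" "s \<otimes> t \<notin> P"
        by (auto simp: zero_locus_def)
      then show "P \<in> (Spec R - zero_locus R S) \<inter> (Spec R - zero_locus R T)"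
        using *[of P s t] by (auto simp: zero_locus_def)
    qed
    moreover have "?W \<subseteq> carrier R" using S T by auto
    ultimately show "\<exists>S\<subseteq>carrier R. U \<inter> V = Spec R - zero_locus R S" by blast
  next
    fix K
    assume "\<forall>U\<in>K. \<exists>S\<subseteq>carrier R. U = Spec R - zero_locus R S"
    then obtain f where f: "\<And>U. U \<in> K \<Longrightarrow> f U \<subseteq> carrier R \<and> U = Spec R - zero_locus R (f U)"
      by metis
    have "\<Union>K = (\<Union>U\<in>K. Spec R - zero_locus R (f U))" using f by auto
    also have "\<dots> = Spec R - zero_locus R (\<Union>U\<in>K. f U)"
      by (auto simp: zero_locus_def)
    finally show "\<exists>S\<subseteq>carrier R. \<Union>K = Spec R - zero_locus R S"
      using f by (intro exI[of _ "\<Union>U\<in>K. f U"]) auto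
  qed
  then show ?thesis by (simp add: zariski_def)
qed


section \<open>Presheaves and sheaves of semirings\<close>

record ('p, 'b) presheaf =
  sect :: "'p set \<Rightarrow> 'b ring"
  restr :: "'p set \<Rightarrow> 'p set \<Rightarrow> 'b \<Rightarrow> 'b"  \<comment> \<open>\<open>restr F U V\<close> goes from \<open>sect F U\<close> to \<open>sect F V\<close>\<close>

locale semiring_presheaf =
  fixes X :: "'p topology" and F :: "('p, 'b) presheaf"
  assumes csemiring_sect: "openin X U \<Longrightarrow> csemiring (sect F U)"
    and restr_hom: "\<lbrakk>openin X U; openin X V; V \<subseteq> U\<rbrakk>
          \<Longrightarrow> restr F U V \<in> semiring_hom (sect F U) (sect F V)"
    and restr_id: "\<lbrakk>openin X U; s \<in> carrier (sect F U)\<rbrakk> \<Longrightarrow> restr F U U s = s"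
    and restr_comp: "\<lbrakk>openin X U; openin X V; openin X W; W \<subseteq> V; V \<subseteq> U; s \<in> carrier (sect F U)\<rbrakk>
          \<Longrightarrow> restr F V W (restr F U V s) = restr F U W s"

locale semiring_sheaf = semiring_presheaf +
  assumes locality: "\<lbrakk>\<And>V. V \<in> \<U> \<Longrightarrow> openin X V;
          s \<in> carrier (sect F (\<Union>\<U>)); t \<in> carrier (sect F (\<Union>\<U>));
          \<And>V. V \<in> \<U> \<Longrightarrow> restr F (\<Union>\<U>) V s = restr F (\<Union>\<U>) V t\<rbrakk> \<Longrightarrow> s = t"
    and gluing: "\<lbrakk>\<And>V. V \<in> \<U> \<Longrightarrow> openin X V;
          \<And>V. V \<in> \<U> \<Longrightarrow> \<sigma> V \<in> carrier (sect F V);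
          \<And>V W. V \<in> \<U> \<Longrightarrow> W \<in> \<U> \<Longrightarrow> restr F V (V \<inter> W) (\<sigma> V) = restr F W (V \<inter> W) (\<sigma> W)\<rbrakk>
          \<Longrightarrow> \<exists>s\<in>carrier (sect F (\<Union>\<U>)). \<forall>V\<in>\<U>. restr F (\<Union>\<U>) V s = \<sigma> V"

definition presheaf_isomorphic :: "'p topology \<Rightarrow> ('p, 'b) presheaf \<Rightarrow> ('p, 'c) presheaf \<Rightarrow> bool" where
  "presheaf_isomorphic X F G \<longleftrightarrow> (\<exists>\<phi>.
     (\<forall>U. openin X U \<longrightarrow> \<phi> U \<in> semiring_iso (sect F U) (sect G U)) \<and>
     (\<forall>U V. openin X U \<and> openin X V \<and> V \<subseteq> U \<longrightarrow>
        (\<forall>s\<in>carrier (sect F U). restr G U V (\<phi> U s) = \<phi> V (restr F U V s))))"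

text \<open>The germ of \<open>s\<close> at \<open>p\<close> is the set of all pairs \<open>(V, t)\<close> such that \<open>t\<close>, a section over
  the open neighbourhood \<open>V\<close> of \<open>p\<close>, agrees with \<open>s\<close> near \<open>p\<close>.\<close>

definition germ :: "'p topology \<Rightarrow> ('p, 'b) presheaf \<Rightarrow> 'p \<Rightarrow> 'p set \<Rightarrow> 'b \<Rightarrow> ('p set \<times> 'b) set" where
  "germ X F p U s = {(V, t). openin X V \<and> p \<in> V \<and> t \<in> carrier (sect F V) \<and>
     (\<exists>W. openin X W \<and> p \<in> W \<and> W \<subseteq> U \<inter> V \<and> restr F U W s = restr F V W t)}"

definition stalk :: "'p topology \<Rightarrow> ('p, 'b) presheaf \<Rightarrow> 'p \<Rightarrow> ('p set \<times> 'b) set ring" where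
  "stalk X F p =
    \<lparr>carrier = {germ X F p U s | U s. openin X U \<and> p \<in> U \<and> s \<in> carrier (sect F U)},
     monoid.mult = (\<lambda>x y. \<Union>(U, s)\<in>x. \<Union>(V, t)\<in>y. germ X F p (U \<inter> V)
        (restr F U (U \<inter> V) s \<otimes>\<^bsub>sect F (U \<inter> V)\<^esub> restr F V (U \<inter> V) t)),
     one = germ X F p (topspace X) \<one>\<^bsub>sect F (topspace X)\<^esub>,
     zero = germ X F p (topspace X) \<zero>\<^bsub>sect F (topspace X)\<^esub>,
     add = (\<lambda>x y. \<Union>(U, s)\<in>x. \<Union>(V, t)\<in>y. germ X F p (U \<inter> V)
        (restr F U (U \<inter> V) s \<oplus>\<^bsub>sect F (U \<inter> V)\<^esub> restr F V (U \<inter> V) t))\<rparr>"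

text \<open>Sections of the sheafification are the families of germs that locally come from a
  section of the presheaf.\<close>

definition sheafification :: "'p topology \<Rightarrow> ('p, 'b) presheaf \<Rightarrow> ('p, 'p \<Rightarrow> ('p set \<times> 'b) set) presheaf" where
  "sheafification X F =
    \<lparr>sect = (\<lambda>U. (product_semiring U (stalk X F))
       \<lparr>carrier := {s \<in> (\<Pi>\<^sub>E p\<in>U. carrier (stalk X F p)).
          \<forall>p\<in>U. \<exists>V t. openin X V \<and> p \<in> V \<and> V \<subseteq> U \<and> t \<in> carrier (sect F V) \<and>
            (\<forall>q\<in>V. s q = germ X F q V t)}\<rparr>),
     restr = (\<lambda>U V s. restrict s V)\<rparr>"

definition to_sheafification ::
    "'p topology \<Rightarrow> ('p, 'b) presheaf \<Rightarrow> 'p set \<Rightarrow> 'b \<Rightarrow> 'p \<Rightarrow> ('p set \<times> 'b) set" where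
  "to_sheafification X F U s = (\<lambda>p\<in>U. germ X F p U s)"


section \<open>The structure presheaf and the three structure sheaves\<close>

definition denom :: "('a, 'm) ring_scheme \<Rightarrow> 'a set set \<Rightarrow> 'a set" where
  "denom R U = {b \<in> carrier R. U \<subseteq> principal_open R b}"

definition pre_struct :: "('a, 'm) ring_scheme \<Rightarrow> ('a set, ('a \<times> 'a) set) presheaf" where
  "pre_struct R =
    \<lparr>sect = (\<lambda>U. localization R (denom R U)),
     restr = (\<lambda>U V. loc_map R (denom R V))\<rparr>"

definition struct_A ::
    "('a, 'm) ring_scheme \<Rightarrow> ('a set, 'a set \<Rightarrow> ('a set set \<times> ('a \<times> 'a) set) set) presheaf" where
  "struct_A R = sheafification (zariski R) (pre_struct R)"

definition equalizer_semiring ::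
    "('a, 'm) ring_scheme \<Rightarrow> 'i set \<Rightarrow> ('i \<Rightarrow> 'a) \<Rightarrow> ('i \<Rightarrow> ('a \<times> 'a) set) ring" where
  "equalizer_semiring R I a =
    (product_semiring I (\<lambda>i. sect (pre_struct R) (principal_open R (a i))))
      \<lparr>carrier := {s \<in> (\<Pi>\<^sub>E i\<in>I. carrier (sect (pre_struct R) (principal_open R (a i)))).
         \<forall>i\<in>I. \<forall>j\<in>I.
           restr (pre_struct R) (principal_open R (a i)) (principal_open R (a i \<otimes>\<^bsub>R\<^esub> a j)) (s i) =
           restr (pre_struct R) (principal_open R (a j)) (principal_open R (a i \<otimes>\<^bsub>R\<^esub> a j)) (s j)}\<rparr>"

text \<open>The extension from the basis of principal opens is built with the largest covering of
  \<open>U\<close>, by all the principal opens contained in it; this makes the restriction maps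
  canonical.\<close>

definition principal_within :: "('a, 'm) ring_scheme \<Rightarrow> 'a set set \<Rightarrow> 'a set" where
  "principal_within R U = {b \<in> carrier R. principal_open R b \<subseteq> U}"

definition struct_B :: "('a, 'm) ring_scheme \<Rightarrow> ('a set, 'a \<Rightarrow> ('a \<times> 'a) set) presheaf" where
  "struct_B R =
    \<lparr>sect = (\<lambda>U. equalizer_semiring R (principal_within R U) (\<lambda>b. b)),
     restr = (\<lambda>U V s. restrict s (principal_within R V))\<rparr>"

definition to_struct_B ::
    "('a, 'm) ring_scheme \<Rightarrow> 'a set set \<Rightarrow> ('a \<times> 'a) set \<Rightarrow> 'a \<Rightarrow> ('a \<times> 'a) set" where
  "to_struct_B R U s = (\<lambda>b\<in>principal_within R U. restr (pre_struct R) U (principal_open R b) s)"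

definition struct_C :: "('a, 'm) ring_scheme \<Rightarrow> ('a set, 'a set \<Rightarrow> ('a \<times> 'a) set) presheaf" where
  "struct_C R =
    \<lparr>sect = (\<lambda>U. (product_semiring U (loc_prime R))
       \<lparr>carrier := {s \<in> (\<Pi>\<^sub>E P\<in>U. carrier (loc_prime R P)).
          \<forall>P\<in>U. \<exists>V a f. openin (zariski R) V \<and> P \<in> V \<and> V \<subseteq> U \<and> a \<in> carrier R \<and> f \<in> carrier R \<and>
            (\<forall>Q\<in>V. f \<notin> Q \<and> s Q = fraction R (carrier R - Q) a f)}\<rparr>),
     restr = (\<lambda>U V s. restrict s V)\<rparr>"

definition to_struct_C ::
    "('a, 'm) ring_scheme \<Rightarrow> 'a set set \<Rightarrow> ('a \<times> 'a) set \<Rightarrow> 'a set \<Rightarrow> ('a \<times> 'a) set" where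
  "to_struct_C R U s = (\<lambda>P\<in>U. loc_map R (carrier R - P) s)"

text \<open>The natural maps from the localization at \<open>a\<close> to the sections over \<open>D(a)\<close> factor
  through \<open>sect (pre_struct R) (principal_open R a)\<close>.\<close>

definition natural_A where
  "natural_A R a = to_sheafification (zariski R) (pre_struct R) (principal_open R a) \<circ>
     loc_map R (denom R (principal_open R a))"

definition natural_B where
  "natural_B R a = to_struct_B R (principal_open R a) \<circ> loc_map R (denom R (principal_open R a))"

definition natural_C where
  "natural_C R a = to_struct_C R (principal_open R a) \<circ> loc_map R (denom R (principal_open R a))"

end

theory Submission
  imports Defs
begin

text \<open>
  Of the three constructions, the functions \<open>s\<close> with values \<open>s(P) \<in> A\<^sub>P\<close> that are locally fractions
  (construction C) are the easiest to handle: they visibly form a sheaf with stalks \<open>A\<^sub>P\<close>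
  (lemmas \<open>semiring_sheaf_struct_C\<close> and \<open>stalk_model_struct_C\<close>). The other two sheaves are compared with
  this one.

  The substance lies in \<open>to_struct_C_iso\<close>: over a principal open set \<open>D(h)\<close>, a function that is
  locally a fraction is given by a single fraction whose denominator is invertible on \<open>D(h)\<close>, and
  by only one such fraction. All passages from primes to equations go through one lemma,
  \<open>power_in_ideal\<close>: an ideal that is contained in no point of \<open>D(h)\<close> contains a power of \<open>h\<close>. It
  rests on the existence of prime ideals that avoid a multiplicative set, whose usual proof by
  Zorn's lemma never subtracts. Injectivity applies it to the ideal of the elements \<open>u\<close> that equalize
  two fractions after multiplication by \<open>u\<close>. For surjectivity, compactness of \<open>D(h)\<close> leaves finitely
  many local fractions, which can be rewritten as \<open>n\<^sub>i/d\<^sub>i\<close> with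
  \<open>n\<^sub>i d\<^sub>j = d\<^sub>i n\<^sub>j\<close> exactly; the elements \<open>x\<close> for which some \<open>y\<close> satisfies
  \<open>y d\<^sub>i = x n\<^sub>i\<close> for all \<open>i\<close> form an ideal containing every \<open>d\<^sub>i\<close>, hence a power
  \<open>x = h\<^sup>m\<close>, and \<open>y/h\<^sup>m\<close> is the required global fraction.

  The rest is formal. Restricting a section of C to the members of a family of principal open sets and
  representing each restriction by its fraction identifies the sections of C over the union with the
  equalizer (\<open>struct_C_equalizer_iso\<close>); for the family of all principal open sets inside \<open>U\<close> this is
  construction B. The stalks of the presheaf of fractions are the semirings \<open>A\<^sub>P\<close>, and under
  these isomorphisms being locally the germ of a section becomes being locally a fraction, which identifies
  the sheafification with C (\<open>C_to_A_iso\<close>). The sheaf axioms, the stalks and the sections over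
  principal open sets are then transported from C along the two isomorphisms.
\<close>

section \<open>Homomorphisms and isomorphisms of semirings\<close>

lemma csemiringI:
  fixes R :: "('a, 'm) ring_scheme" (structure)
  assumes "\<And>x y. x \<in> carrier R \<Longrightarrow> y \<in> carrier R \<Longrightarrow> x \<oplus> y \<in> carrier R"
    and "\<And>x y. x \<in> carrier R \<Longrightarrow> y \<in> carrier R \<Longrightarrow> x \<otimes> y \<in> carrier R"
    and "\<zero> \<in> carrier R" and "\<one> \<in> carrier R"
    and "\<And>x y z. x \<in> carrier R \<Longrightarrow> y \<in> carrier R \<Longrightarrow> z \<in> carrier R \<Longrightarrow> (x \<oplus> y) \<oplus> z = x \<oplus> (y \<oplus> z)"
    and "\<And>x y z. x \<in> carrier R \<Longrightarrow> y \<in> carrier R \<Longrightarrow> z \<in> carrier R \<Longrightarrow> (x \<otimes> y) \<otimes> z = x \<otimes> (y \<otimes> z)"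
    and "\<And>x y. x \<in> carrier R \<Longrightarrow> y \<in> carrier R \<Longrightarrow> x \<oplus> y = y \<oplus> x"
    and "\<And>x y. x \<in> carrier R \<Longrightarrow> y \<in> carrier R \<Longrightarrow> x \<otimes> y = y \<otimes> x"
    and "\<And>x. x \<in> carrier R \<Longrightarrow> \<zero> \<oplus> x = x"
    and "\<And>x. x \<in> carrier R \<Longrightarrow> \<one> \<otimes> x = x"
    and "\<And>x. x \<in> carrier R \<Longrightarrow> \<zero> \<otimes> x = \<zero>"
    and "\<And>x y z. x \<in> carrier R \<Longrightarrow> y \<in> carrier R \<Longrightarrow> z \<in> carrier R \<Longrightarrow> (x \<oplus> y) \<otimes> z = x \<otimes> z \<oplus> y \<otimes> z"
  shows "csemiring R"
proof -
  have M: "comm_monoid R" by (rule comm_monoidI) (use assms in auto)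
  moreover have "abelian_monoid R" by (rule abelian_monoidI) (use assms in auto)
  moreover have "semiring_axioms R"
  proof
    show "z \<otimes> (x \<oplus> y) = z \<otimes> x \<oplus> z \<otimes> y"
      if "x \<in> carrier R" "y \<in> carrier R" "z \<in> carrier R" for x y z
      using that assms(1,8,12) by metis
    show "x \<otimes> \<zero> = \<zero>" if "x \<in> carrier R" for x
      using that assms(3,8,11) by metis
  qed (use assms in auto)
  ultimately show ?thesis
    by (intro csemiring.intro semiring.intro comm_monoid.axioms(1))
qed

lemma semiring_homI:
  assumes "\<And>x. x \<in> carrier R \<Longrightarrow> h x \<in> carrier S"
    and "\<And>x y. x \<in> carrier R \<Longrightarrow> y \<in> carrier R \<Longrightarrow> h (x \<otimes>\<^bsub>R\<^esub> y) = h x \<otimes>\<^bsub>S\<^esub> h y"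
    and "\<And>x y. x \<in> carrier R \<Longrightarrow> y \<in> carrier R \<Longrightarrow> h (x \<oplus>\<^bsub>R\<^esub> y) = h x \<oplus>\<^bsub>S\<^esub> h y"
    and "h \<one>\<^bsub>R\<^esub> = \<one>\<^bsub>S\<^esub>" and "h \<zero>\<^bsub>R\<^esub> = \<zero>\<^bsub>S\<^esub>"
  shows "h \<in> semiring_hom R S"
  using assms by (auto simp: semiring_hom_def ring_hom_def)

lemma semiring_homD:
  assumes "h \<in> semiring_hom R S"
  shows "x \<in> carrier R \<Longrightarrow> h x \<in> carrier S"
    and "x \<in> carrier R \<Longrightarrow> y \<in> carrier R \<Longrightarrow> h (x \<otimes>\<^bsub>R\<^esub> y) = h x \<otimes>\<^bsub>S\<^esub> h y"
    and "x \<in> carrier R \<Longrightarrow> y \<in> carrier R \<Longrightarrow> h (x \<oplus>\<^bsub>R\<^esub> y) = h x \<oplus>\<^bsub>S\<^esub> h y"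
    and "h \<one>\<^bsub>R\<^esub> = \<one>\<^bsub>S\<^esub>" and "h \<zero>\<^bsub>R\<^esub> = \<zero>\<^bsub>S\<^esub>"
  using assms by (auto simp: semiring_hom_def ring_hom_def)

lemma semiring_isoI:
  "h \<in> semiring_hom R S \<Longrightarrow> inj_on h (carrier R) \<Longrightarrow> carrier S \<subseteq> h ` carrier R \<Longrightarrow>
    h \<in> semiring_iso R S"
  using semiring_homD(1)[of h R S] by (force simp: semiring_iso_def bij_betw_def)

lemma semiring_isoD:
  assumes "h \<in> semiring_iso R S"
  shows "h \<in> semiring_hom R S" "inj_on h (carrier R)" "h ` carrier R = carrier S"
  using assms by (auto simp: semiring_iso_def bij_betw_def)

context csemiring
begin

lemma closed_ops [simp, intro]:
  "x \<in> carrier R \<Longrightarrow> y \<in> carrier R \<Longrightarrow> x \<oplus> y \<in> carrier R"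
  "x \<in> carrier R \<Longrightarrow> y \<in> carrier R \<Longrightarrow> x \<otimes> y \<in> carrier R"
  "\<zero> \<in> carrier R" "\<one> \<in> carrier R"
  by auto

lemma semiring_hom_cong:
  assumes "h \<in> semiring_hom R S" "\<And>x. x \<in> carrier R \<Longrightarrow> g x = h x"
  shows "g \<in> semiring_hom R S"
  using assms semiring_homD[OF assms(1)] by (intro semiring_homI) auto

lemma semiring_iso_cong:
  assumes "h \<in> semiring_iso R S" "\<And>x. x \<in> carrier R \<Longrightarrow> g x = h x"
  shows "g \<in> semiring_iso R S"
  using assms semiring_hom_cong[of h S g] bij_betw_cong[of "carrier R" g h "carrier S"]
  by (auto simp: semiring_iso_def)

text \<open>An isomorphism carries all laws over to its image, closure of the carrier included. Structures
  with complicated carriers are therefore recognized as semirings by an isomorphism that starts from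
  a structure already known to be one.\<close>

lemma csemiring_iso_image:
  assumes h: "h \<in> semiring_iso R S"
  shows "csemiring S"
proof -
  note H = semiring_homD[OF semiring_isoD(1)[OF h]]
  have rep: "\<exists>x'\<in>carrier R. x = h x'" if "x \<in> carrier S" for x
    using semiring_isoD(3)[OF h] that by blast
  show ?thesis
  proof (rule csemiringI)
    show "x \<oplus>\<^bsub>S\<^esub> y \<in> carrier S" "x \<otimes>\<^bsub>S\<^esub> y \<in> carrier S" if "x \<in> carrier S" "y \<in> carrier S" for x y
      using that rep[of x] rep[of y] H(1) by (auto simp flip: H(2,3))
    show "\<zero>\<^bsub>S\<^esub> \<in> carrier S" "\<one>\<^bsub>S\<^esub> \<in> carrier S" using H by (metis closed_ops(3,4))+
    show "(x \<oplus>\<^bsub>S\<^esub> y) \<oplus>\<^bsub>S\<^esub> z = x \<oplus>\<^bsub>S\<^esub> (y \<oplus>\<^bsub>S\<^esub> z)" "(x \<otimes>\<^bsub>S\<^esub> y) \<otimes>\<^bsub>S\<^esub> z = x \<otimes>\<^bsub>S\<^esub> (y \<otimes>\<^bsub>S\<^esub> z)"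
      "(x \<oplus>\<^bsub>S\<^esub> y) \<otimes>\<^bsub>S\<^esub> z = x \<otimes>\<^bsub>S\<^esub> z \<oplus>\<^bsub>S\<^esub> y \<otimes>\<^bsub>S\<^esub> z"
      if "x \<in> carrier S" "y \<in> carrier S" "z \<in> carrier S" for x y z
      using that rep[of x] rep[of y] rep[of z]
      by (auto simp flip: H(2,3) simp: a_assoc m_assoc l_distr)
    show "x \<oplus>\<^bsub>S\<^esub> y = y \<oplus>\<^bsub>S\<^esub> x" "x \<otimes>\<^bsub>S\<^esub> y = y \<otimes>\<^bsub>S\<^esub> x" if "x \<in> carrier S" "y \<in> carrier S" for x y
      using that rep[of x] rep[of y] H(2,3) a_comm m_comm by metis+
    show "\<zero>\<^bsub>S\<^esub> \<oplus>\<^bsub>S\<^esub> x = x" "\<one>\<^bsub>S\<^esub> \<otimes>\<^bsub>S\<^esub> x = x" "\<zero>\<^bsub>S\<^esub> \<otimes>\<^bsub>S\<^esub> x = \<zero>\<^bsub>S\<^esub>" if "x \<in> carrier S" for x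
      using that rep[of x] by (auto simp flip: H(2-5))
  qed
qed

lemma semiring_iso_inverse:
  assumes h: "h \<in> semiring_iso R S"
  shows "inv_into (carrier R) h \<in> semiring_iso S R"
proof -
  let ?g = "inv_into (carrier R) h"
  note H = semiring_homD[OF semiring_isoD(1)[OF h]]
  have gh: "?g (h x) = x" if "x \<in> carrier R" for x
    using inv_into_f_f[OF semiring_isoD(2)[OF h] that] .
  have S: "carrier S = h ` carrier R" using semiring_isoD(3)[OF h] by simp
  have "?g \<in> semiring_hom S R"
    by (rule semiring_homI; (unfold S)?; (elim imageE)?)
      (auto simp flip: H(2-5) simp: gh)
  moreover have "bij_betw ?g (carrier S) (carrier R)"
    using h by (auto simp: semiring_iso_def intro: bij_betw_inv_into)
  ultimately show ?thesis by (simp add: semiring_iso_def)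
qed

lemma semiring_isomorphic_sym:
  "semiring_isomorphic R S \<Longrightarrow> semiring_isomorphic S R"
  unfolding semiring_isomorphic_def using semiring_iso_inverse by blast

end

lemma semiring_hom_comp:
  "h \<in> semiring_hom R S \<Longrightarrow> g \<in> semiring_hom S T \<Longrightarrow> (\<lambda>x. g (h x)) \<in> semiring_hom R T"
  by (auto simp: semiring_hom_def ring_hom_def Pi_iff)

lemma semiring_iso_comp:
  "h \<in> semiring_iso R S \<Longrightarrow> g \<in> semiring_iso S T \<Longrightarrow> (\<lambda>x. g (h x)) \<in> semiring_iso R T"
  using semiring_hom_comp[of h R S g T] bij_betw_trans[of h "carrier R" "carrier S" g "carrier T"]
  by (auto simp: semiring_iso_def comp_def)

text \<open>Sections of each of the three sheaves are families of elements, with pointwise operations, that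
  satisfy a condition; \<open>K\<close> is the set of admissible families.\<close>

abbreviation subproduct :: "'i set \<Rightarrow> ('i \<Rightarrow> 'b ring) \<Rightarrow> ('i \<Rightarrow> 'b) set \<Rightarrow> ('i \<Rightarrow> 'b) ring" where
  "subproduct I R K \<equiv> (product_semiring I R)\<lparr>carrier := K\<rparr>"

lemma product_semiring_simps:
  "x \<otimes>\<^bsub>product_semiring I R\<^esub> y = (\<lambda>i\<in>I. x i \<otimes>\<^bsub>R i\<^esub> y i)"
  "x \<oplus>\<^bsub>product_semiring I R\<^esub> y = (\<lambda>i\<in>I. x i \<oplus>\<^bsub>R i\<^esub> y i)"
  "\<one>\<^bsub>product_semiring I R\<^esub> = (\<lambda>i\<in>I. \<one>\<^bsub>R i\<^esub>)"
  "\<zero>\<^bsub>product_semiring I R\<^esub> = (\<lambda>i\<in>I. \<zero>\<^bsub>R i\<^esub>)"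
  by (simp_all add: product_semiring_def)

lemma csemiring_subproduct:
  assumes R: "\<And>i. i \<in> I \<Longrightarrow> csemiring (R i)"
    and K: "K \<subseteq> (\<Pi>\<^sub>E i\<in>I. carrier (R i))"
    and one: "(\<lambda>i\<in>I. \<one>\<^bsub>R i\<^esub>) \<in> K" and zero: "(\<lambda>i\<in>I. \<zero>\<^bsub>R i\<^esub>) \<in> K"
    and mult: "\<And>x y. x \<in> K \<Longrightarrow> y \<in> K \<Longrightarrow> (\<lambda>i\<in>I. x i \<otimes>\<^bsub>R i\<^esub> y i) \<in> K"
    and add: "\<And>x y. x \<in> K \<Longrightarrow> y \<in> K \<Longrightarrow> (\<lambda>i\<in>I. x i \<oplus>\<^bsub>R i\<^esub> y i) \<in> K"
  shows "csemiring (subproduct I R K)"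
proof -
  have Kc: "x i \<in> carrier (R i)" if "x \<in> K" "i \<in> I" for x i using K that by auto
  have eqI: "x = y" if "x \<in> K" "y \<in> K" "\<And>i. i \<in> I \<Longrightarrow> x i = y i" for x y
    using that K by (meson PiE_ext subsetD)
  note sr = csemiring.axioms(1)[OF R]
  note am = semiring.axioms(1)[OF sr]
  note cm = csemiring.axioms(2)[OF R]
  note mo = comm_monoid.axioms(1)[OF cm]
  note laws = abelian_monoid.a_assoc[OF am] monoid.m_assoc[OF mo] abelian_monoid.a_comm[OF am]
    comm_monoid.m_comm[OF cm] abelian_monoid.l_zero[OF am] monoid.l_one[OF mo]
    semiring.l_null[OF sr] semiring.l_distr[OF sr]
  show ?thesis
    by (rule csemiringI; simp add: product_semiring_simps one zero mult add del: restrict_apply;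
        rule eqI; (simp add: one zero mult add del: restrict_apply; fail | simp add: Kc laws))
qed

lemma semiring_hom_into_subproduct:
  assumes h: "\<And>i. i \<in> I \<Longrightarrow> h i \<in> semiring_hom Q (R i)"
    and "\<And>x. x \<in> carrier Q \<Longrightarrow> (\<lambda>i\<in>I. h i x) \<in> K"
  shows "(\<lambda>x. \<lambda>i\<in>I. h i x) \<in> semiring_hom Q (subproduct I R K)"
  using assms(2) semiring_homD[OF h]
  by (intro semiring_homI) (auto simp: product_semiring_simps intro!: restrict_ext)

lemma semiring_hom_projection:
  assumes "K \<subseteq> (\<Pi>\<^sub>E i\<in>I. carrier (R i))" "i \<in> I"
  shows "(\<lambda>x. x i) \<in> semiring_hom (subproduct I R K) (R i)"
  using assms by (intro semiring_homI) (auto simp: product_semiring_simps)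


section \<open>Localization of semirings\<close>

text \<open>Operations on fractions and on germs are unions over pairs of representatives; this evaluates
  such a union once all representatives give the same result.\<close>

lemma UN_pairs_const:
  assumes "(a, s) \<in> x" "(b, t) \<in> y"
    and "\<And>a s b t. (a, s) \<in> x \<Longrightarrow> (b, t) \<in> y \<Longrightarrow> f a s b t = c"
  shows "(\<Union>(a, s)\<in>x. \<Union>(b, t)\<in>y. f a s b t) = c"
proof -
  have "(\<Union>(a, s)\<in>x. \<Union>(b, t)\<in>y. f a s b t) = (\<Union>p\<in>x. \<Union>q\<in>y. c)"
    using assms(3) by (intro SUP_cong refl) (auto simp: split_beta)
  then show ?thesis using assms(1,2) by auto
qed

context csemiring
begin

lemma fraction_rel_trans:
  assumes S: "submonoid S R" and c: "a \<in> carrier R" "b \<in> carrier R" "c \<in> carrier R"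
    and s: "s \<in> S" "t \<in> S" "v \<in> S"
    and "\<exists>u\<in>S. a \<otimes> t \<otimes> u = b \<otimes> s \<otimes> u" "\<exists>u\<in>S. b \<otimes> v \<otimes> u = c \<otimes> t \<otimes> u"
  shows "\<exists>u\<in>S. a \<otimes> v \<otimes> u = c \<otimes> s \<otimes> u"
proof -
  obtain u w where u: "u \<in> S" "a \<otimes> t \<otimes> u = b \<otimes> s \<otimes> u"
    and w: "w \<in> S" "b \<otimes> v \<otimes> w = c \<otimes> t \<otimes> w" using assms by blast
  have S': "x \<in> carrier R" if "x \<in> S" for x using submonoid.subset[OF S] that by auto
  note cl = c s[THEN S'] u(1)[THEN S'] w(1)[THEN S']
  \<comment> \<open>the middle denominator \<open>t\<close> cannot be cancelled, so it joins the witness\<close>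
  have "a \<otimes> v \<otimes> (t \<otimes> u \<otimes> w) = (a \<otimes> t \<otimes> u) \<otimes> (v \<otimes> w)" using cl by (simp add: m_ac)
  also have "\<dots> = (b \<otimes> v \<otimes> w) \<otimes> (s \<otimes> u)" unfolding u(2) using cl by (simp add: m_ac)
  also have "\<dots> = c \<otimes> s \<otimes> (t \<otimes> u \<otimes> w)" unfolding w(2) using cl by (simp add: m_ac)
  finally show ?thesis using S s u(1) w(1) by (metis submonoid.m_closed)
qed

lemma fraction_eq_iff:
  assumes S: "submonoid S R" and c: "a \<in> carrier R" "b \<in> carrier R" and s: "s \<in> S" "t \<in> S"
  shows "fraction R S a s = fraction R S b t \<longleftrightarrow> (\<exists>u\<in>S. a \<otimes> t \<otimes> u = b \<otimes> s \<otimes> u)"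
proof
  assume "fraction R S a s = fraction R S b t"
  moreover have "(b, t) \<in> fraction R S b t"
    using assms submonoid.one_closed[OF S] by (auto simp: fraction_def)
  ultimately have "(b, t) \<in> fraction R S a s" by simp
  then show "\<exists>u\<in>S. a \<otimes> t \<otimes> u = b \<otimes> s \<otimes> u" by (simp add: fraction_def)
next
  assume *: "\<exists>u\<in>S. a \<otimes> t \<otimes> u = b \<otimes> s \<otimes> u"
  then have **: "\<exists>u\<in>S. b \<otimes> s \<otimes> u = a \<otimes> t \<otimes> u" by metis
  show "fraction R S a s = fraction R S b t"
    using fraction_rel_trans[OF S c(2,1) _ s(2,1) _ **] fraction_rel_trans[OF S c _ s _ *]
    unfolding fraction_def by blast
qed

lemma fraction_rep:
  assumes "submonoid S R" "a \<in> carrier R" "s \<in> S"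
  shows "(a, s) \<in> fraction R S a s"
    and "(b, t) \<in> fraction R S a s \<Longrightarrow> b \<in> carrier R \<and> t \<in> S \<and> fraction R S b t = fraction R S a s"
proof -
  show "(a, s) \<in> fraction R S a s"
    using assms submonoid.one_closed[of S R] by (auto simp: fraction_def)
  show "b \<in> carrier R \<and> t \<in> S \<and> fraction R S b t = fraction R S a s" if "(b, t) \<in> fraction R S a s"
    using assms that fraction_eq_iff[of S b a t s] by (fastforce simp: fraction_def)
qed

lemma fraction_mult:
  assumes S: "submonoid S R" and c: "a \<in> carrier R" "b \<in> carrier R" and s: "s \<in> S" "t \<in> S"
  shows "fraction R S a s \<otimes>\<^bsub>localization R S\<^esub> fraction R S b t = fraction R S (a \<otimes> b) (s \<otimes> t)"
proof -
  have "fraction R S (a' \<otimes> b') (s' \<otimes> t') = fraction R S (a \<otimes> b) (s \<otimes> t)"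
    if ab: "(a', s') \<in> fraction R S a s" "(b', t') \<in> fraction R S b t" for a' s' b' t'
  proof -
    have S': "x \<in> carrier R" if "x \<in> S" for x using submonoid.subset[OF S] that by auto
    obtain u w where u: "a' \<in> carrier R" "s' \<in> S" "u \<in> S" "a \<otimes> s' \<otimes> u = a' \<otimes> s \<otimes> u"
      and w: "b' \<in> carrier R" "t' \<in> S" "w \<in> S" "b \<otimes> t' \<otimes> w = b' \<otimes> t \<otimes> w"
      using ab unfolding fraction_def by blast
    note cl = c s[THEN S'] u(1) w(1) u(2,3)[THEN S'] w(2,3)[THEN S']
    have "(a' \<otimes> b') \<otimes> (s \<otimes> t) \<otimes> (u \<otimes> w) = (a' \<otimes> s \<otimes> u) \<otimes> (b' \<otimes> t \<otimes> w)"
      using cl by (simp add: m_ac)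
    also have "\<dots> = (a \<otimes> b) \<otimes> (s' \<otimes> t') \<otimes> (u \<otimes> w)"
      unfolding u(4)[symmetric] w(4)[symmetric] using cl by (simp add: m_ac)
    finally show ?thesis
      using cl s u w S by (subst fraction_eq_iff) (auto intro: submonoid.m_closed)
  qed
  then show ?thesis
    by (simp add: localization_def)
      (rule UN_pairs_const[OF fraction_rep(1)[OF S c(1) s(1)] fraction_rep(1)[OF S c(2) s(2)]])
qed

lemma fraction_add:
  assumes S: "submonoid S R" and c: "a \<in> carrier R" "b \<in> carrier R" and s: "s \<in> S" "t \<in> S"
  shows "fraction R S a s \<oplus>\<^bsub>localization R S\<^esub> fraction R S b t =
    fraction R S (a \<otimes> t \<oplus> b \<otimes> s) (s \<otimes> t)"
proof -
  have "fraction R S (a' \<otimes> t' \<oplus> b' \<otimes> s') (s' \<otimes> t') = fraction R S (a \<otimes> t \<oplus> b \<otimes> s) (s \<otimes> t)"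
    if ab: "(a', s') \<in> fraction R S a s" "(b', t') \<in> fraction R S b t" for a' s' b' t'
  proof -
    have S': "x \<in> carrier R" if "x \<in> S" for x using submonoid.subset[OF S] that by auto
    obtain u w where u: "a' \<in> carrier R" "s' \<in> S" "u \<in> S" "a \<otimes> s' \<otimes> u = a' \<otimes> s \<otimes> u"
      and w: "b' \<in> carrier R" "t' \<in> S" "w \<in> S" "b \<otimes> t' \<otimes> w = b' \<otimes> t \<otimes> w"
      using ab unfolding fraction_def by blast
    note cl = c s[THEN S'] u(1) w(1) u(2,3)[THEN S'] w(2,3)[THEN S']
    have "(a' \<otimes> t' \<oplus> b' \<otimes> s') \<otimes> (s \<otimes> t) \<otimes> (u \<otimes> w) =
        (a' \<otimes> s \<otimes> u) \<otimes> (t \<otimes> t' \<otimes> w) \<oplus> (b' \<otimes> t \<otimes> w) \<otimes> (s \<otimes> s' \<otimes> u)"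
      using cl by (simp add: l_distr r_distr m_ac)
    also have "\<dots> = (a \<otimes> t \<oplus> b \<otimes> s) \<otimes> (s' \<otimes> t') \<otimes> (u \<otimes> w)"
      unfolding u(4)[symmetric] w(4)[symmetric] using cl by (simp add: l_distr r_distr m_ac)
    finally show ?thesis
      using cl s u w S by (subst fraction_eq_iff) (auto intro: submonoid.m_closed)
  qed
  then show ?thesis
    by (simp add: localization_def)
      (rule UN_pairs_const[OF fraction_rep(1)[OF S c(1) s(1)] fraction_rep(1)[OF S c(2) s(2)]])
qed

lemma localization_simps:
  "carrier (localization R S) = {fraction R S a s | a s. a \<in> carrier R \<and> s \<in> S}"
  "\<one>\<^bsub>localization R S\<^esub> = fraction R S \<one> \<one>"
  "\<zero>\<^bsub>localization R S\<^esub> = fraction R S \<zero> \<one>"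
  by (simp_all add: localization_def)

lemma csemiring_localization:
  assumes S: "submonoid S R"
  shows "csemiring (localization R S)"
proof -
  have S': "x \<in> carrier R" if "x \<in> S" for x using submonoid.subset[OF S] that by auto
  note eqs = fraction_add[OF S] fraction_mult[OF S] localization_simps(2,3)
  have cl: "fraction R S a s \<in> carrier (localization R S)" if "a \<in> carrier R" "s \<in> S" for a s
    using that by (auto simp: localization_simps)
  have rep: "\<exists>a s. x = fraction R S a s \<and> a \<in> carrier R \<and> s \<in> S"
    if "x \<in> carrier (localization R S)" for x using that by (auto simp: localization_simps)
  have eqI: "fraction R S a s = fraction R S b t"
    if "a \<otimes> t = b \<otimes> s" "a \<in> carrier R" "b \<in> carrier R" "s \<in> S" "t \<in> S" for a b s t
    using that submonoid.one_closed[OF S] by (subst fraction_eq_iff[OF S]) auto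
  show ?thesis
  proof (rule csemiringI)
    fix x y assume "x \<in> carrier (localization R S)" "y \<in> carrier (localization R S)"
    then obtain a s b t where xy: "x = fraction R S a s" "y = fraction R S b t"
      and c: "a \<in> carrier R" "b \<in> carrier R" "s \<in> S" "t \<in> S" using rep by meson
    show "x \<oplus>\<^bsub>localization R S\<^esub> y \<in> carrier (localization R S)"
      "x \<otimes>\<^bsub>localization R S\<^esub> y \<in> carrier (localization R S)"
      using c by (auto simp: xy eqs S' submonoid.m_closed[OF S] intro!: cl)
    show "x \<oplus>\<^bsub>localization R S\<^esub> y = y \<oplus>\<^bsub>localization R S\<^esub> x"
      "x \<otimes>\<^bsub>localization R S\<^esub> y = y \<otimes>\<^bsub>localization R S\<^esub> x"
      using c by (simp_all add: xy eqs S' a_comm[of "a \<otimes> t"] m_comm[of s t] m_comm[of a b])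
  next
    fix x y z assume "x \<in> carrier (localization R S)" "y \<in> carrier (localization R S)"
      "z \<in> carrier (localization R S)"
    then obtain a s b t d v where xyz: "x = fraction R S a s" "y = fraction R S b t" "z = fraction R S d v"
      and c: "a \<in> carrier R" "b \<in> carrier R" "d \<in> carrier R" "s \<in> S" "t \<in> S" "v \<in> S"
      using rep by meson
    note cl = c S'[OF c(4)] S'[OF c(5)] S'[OF c(6)] submonoid.m_closed[OF S]
    show "x \<oplus>\<^bsub>localization R S\<^esub> y \<oplus>\<^bsub>localization R S\<^esub> z =
        x \<oplus>\<^bsub>localization R S\<^esub> (y \<oplus>\<^bsub>localization R S\<^esub> z)"
      using cl by (simp add: xyz eqs) (intro arg_cong2[of _ _ _ _ "fraction R S"]; simp add: l_distr r_distr m_ac a_ac)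
    show "x \<otimes>\<^bsub>localization R S\<^esub> y \<otimes>\<^bsub>localization R S\<^esub> z =
        x \<otimes>\<^bsub>localization R S\<^esub> (y \<otimes>\<^bsub>localization R S\<^esub> z)"
      using cl by (simp add: xyz eqs m_assoc)
    show "(x \<oplus>\<^bsub>localization R S\<^esub> y) \<otimes>\<^bsub>localization R S\<^esub> z =
        x \<otimes>\<^bsub>localization R S\<^esub> z \<oplus>\<^bsub>localization R S\<^esub> y \<otimes>\<^bsub>localization R S\<^esub> z"
      using cl by (simp add: xyz eqs) (intro eqI; simp add: l_distr r_distr m_ac)
  next
    fix x assume "x \<in> carrier (localization R S)"
    then obtain a s where x: "x = fraction R S a s" and c: "a \<in> carrier R" "s \<in> S" using rep by meson
    note cl = c S'[OF c(2)] submonoid.one_closed[OF S] submonoid.m_closed[OF S]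
    show "\<zero>\<^bsub>localization R S\<^esub> \<oplus>\<^bsub>localization R S\<^esub> x = x" "\<one>\<^bsub>localization R S\<^esub> \<otimes>\<^bsub>localization R S\<^esub> x = x"
      using cl by (simp_all add: x eqs)
    show "\<zero>\<^bsub>localization R S\<^esub> \<otimes>\<^bsub>localization R S\<^esub> x = \<zero>\<^bsub>localization R S\<^esub>"
      using cl by (simp add: x eqs) (intro eqI; simp)
  qed (simp_all add: localization_simps(2,3) cl submonoid.one_closed[OF S])
qed

lemma loc_map_fraction:
  assumes S: "submonoid S R" and T: "submonoid T R" and "S \<subseteq> T" "a \<in> carrier R" "s \<in> S"
  shows "loc_map R T (fraction R S a s) = fraction R T a s"
proof -
  have "fraction R T b t = fraction R T a s" if "(b, t) \<in> fraction R S a s" for b t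
  proof -
    have b: "b \<in> carrier R" "t \<in> S" "fraction R S b t = fraction R S a s"
      using fraction_rep(2)[OF S assms(4,5) that] by auto
    then have "\<exists>u\<in>T. b \<otimes> s \<otimes> u = a \<otimes> t \<otimes> u"
      using assms fraction_eq_iff[OF S b(1) assms(4) b(2) assms(5)] by blast
    then show ?thesis using assms b by (subst fraction_eq_iff[OF T]) auto
  qed
  then have "loc_map R T (fraction R S a s) = (\<Union>p\<in>fraction R S a s. fraction R T a s)"
    unfolding loc_map_def by (intro SUP_cong refl) (auto simp: split_beta)
  then show ?thesis using fraction_rep(1)[OF S assms(4,5)] by auto
qed

lemma loc_map_hom:
  assumes S: "submonoid S R" and T: "submonoid T R" and "S \<subseteq> T"
  shows "loc_map R T \<in> semiring_hom (localization R S) (localization R T)"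
proof -
  have S': "s \<in> carrier R" "s \<in> T" if "s \<in> S" for s using submonoid.subset[OF S] assms(3) that by auto
  note simps = loc_map_fraction[OF assms] fraction_mult[OF S] fraction_mult[OF T]
    fraction_add[OF S] fraction_add[OF T] submonoid.one_closed[OF S] submonoid.m_closed[OF S] S'
  show ?thesis
    by (rule semiring_homI) (auto simp: localization_simps simps, blast intro: S'(2))
qed

lemma submonoid_powers: "a \<in> carrier R \<Longrightarrow> submonoid {a [^] n | n::nat. True} R"
  by unfold_locales (auto simp: nat_pow_mult intro: exI[of _ 0])

end

section \<open>Prime ideals and the Zariski topology\<close>

context csemiring
begin

lemma semiring_idealD:
  assumes "semiring_ideal R I"
  shows "I \<subseteq> carrier R" "\<zero> \<in> I" "x \<in> I \<Longrightarrow> y \<in> I \<Longrightarrow> x \<oplus> y \<in> I"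
    "a \<in> carrier R \<Longrightarrow> x \<in> I \<Longrightarrow> a \<otimes> x \<in> I"
  using assms by (auto simp: semiring_ideal_def)

lemma prime_mult_iff:
  assumes "P \<in> Spec R" "a \<in> carrier R" "b \<in> carrier R"
  shows "a \<otimes> b \<in> P \<longleftrightarrow> a \<in> P \<or> b \<in> P"
proof -
  have P: "semiring_prime R P" using assms(1) by (simp add: Spec_def)
  have "a \<otimes> b \<in> P" if "b \<in> P"
    using P assms(2) that unfolding semiring_prime_def semiring_ideal_def by blast
  moreover have "b \<otimes> a \<in> P" if "a \<in> P"
    using P assms(3) that unfolding semiring_prime_def semiring_ideal_def by blast
  ultimately show ?thesis
    using P assms(2,3) m_comm[OF assms(2,3)] unfolding semiring_prime_def by metis
qed

lemma one_notin_prime: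
  assumes "P \<in> Spec R" shows "\<one> \<notin> P"
proof
  assume "\<one> \<in> P"
  then have "carrier R \<subseteq> P"
    using assms prime_mult_iff[OF assms _ closed_ops(4)] by auto
  then show False using assms by (auto simp: Spec_def semiring_prime_def semiring_ideal_def)
qed

lemma prime_power_iff:
  assumes "P \<in> Spec R" "a \<in> carrier R"
  shows "a [^] (n::nat) \<in> P \<longleftrightarrow> a \<in> P \<and> n > 0"
  by (induction n) (use assms one_notin_prime prime_mult_iff in auto)

lemma prime_ideal: "P \<in> Spec R \<Longrightarrow> semiring_ideal R P"
  by (auto simp: Spec_def semiring_prime_def)

lemma submonoid_prime_compl: "P \<in> Spec R \<Longrightarrow> submonoid (carrier R - P) R"
  by unfold_locales (auto simp: prime_mult_iff one_notin_prime)

lemma csemiring_loc_prime: "P \<in> Spec R \<Longrightarrow> csemiring (loc_prime R P)"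
  unfolding loc_prime_def by (intro csemiring_localization submonoid_prime_compl)

lemma ideal_adjoin:
  assumes I: "semiring_ideal R I" and a: "a \<in> carrier R"
  shows "semiring_ideal R {i \<oplus> r \<otimes> a | i r. i \<in> I \<and> r \<in> carrier R}"
proof -
  note D = semiring_idealD[OF I]
  have 1: "(i \<oplus> r \<otimes> a) \<oplus> (j \<oplus> t \<otimes> a) = (i \<oplus> j) \<oplus> (r \<oplus> t) \<otimes> a"
    if "i \<in> I" "j \<in> I" "r \<in> carrier R" "t \<in> carrier R" for i j r t
    using that D(1) a by (auto simp: l_distr a_ac subset_iff)
  have 2: "x \<otimes> (i \<oplus> r \<otimes> a) = (x \<otimes> i) \<oplus> (x \<otimes> r) \<otimes> a"
    if "i \<in> I" "x \<in> carrier R" "r \<in> carrier R" for i x r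
    using that D(1) a by (auto simp: r_distr m_assoc subset_iff)
  show ?thesis
    unfolding semiring_ideal_def
  proof (intro conjI ballI)
    show "{i \<oplus> r \<otimes> a | i r. i \<in> I \<and> r \<in> carrier R} \<subseteq> carrier R" using a D(1) by auto
    have "\<zero> = \<zero> \<oplus> \<zero> \<otimes> a" using a by simp
    then show "\<zero> \<in> {i \<oplus> r \<otimes> a | i r. i \<in> I \<and> r \<in> carrier R}" using D(2) by blast
  next
    fix x y assume "x \<in> {i \<oplus> r \<otimes> a | i r. i \<in> I \<and> r \<in> carrier R}"
      "y \<in> {i \<oplus> r \<otimes> a | i r. i \<in> I \<and> r \<in> carrier R}"
    then obtain i r j t where *: "x = i \<oplus> r \<otimes> a" "y = j \<oplus> t \<otimes> a" "i \<in> I" "j \<in> I"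
      "r \<in> carrier R" "t \<in> carrier R" by blast
    then show "x \<oplus> y \<in> {i \<oplus> r \<otimes> a | i r. i \<in> I \<and> r \<in> carrier R}"
      using 1[of i j r t] D(3)[of i j] closed_ops(1)[of r t] by blast
  next
    fix x y assume "x \<in> carrier R" "y \<in> {i \<oplus> r \<otimes> a | i r. i \<in> I \<and> r \<in> carrier R}"
    then obtain i r where *: "y = i \<oplus> r \<otimes> a" "i \<in> I" "r \<in> carrier R" "x \<in> carrier R" by blast
    then show "x \<otimes> y \<in> {i \<oplus> r \<otimes> a | i r. i \<in> I \<and> r \<in> carrier R}"
      using 2[of i x r] D(4)[of x i] closed_ops(2)[of x r] by blast
  qed
qed

text \<open>Krull's argument survives without subtraction: if \<open>M\<close> is maximal among the ideals disjoint from
  \<open>S\<close> and \<open>a, b \<notin> M\<close>, then both \<open>M + (a)\<close> and \<open>M + (b)\<close> meet \<open>S\<close>, and the product of two common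
  elements lies in \<open>S\<close> and in \<open>M + (ab)\<close>, so that \<open>ab \<notin> M\<close>.\<close>

lemma exists_prime_avoiding:
  assumes J: "semiring_ideal R J" and S: "submonoid S R" and disj: "J \<inter> S = {}"
  shows "\<exists>P\<in>Spec R. J \<subseteq> P \<and> P \<inter> S = {}"
proof -
  define \<A> where "\<A> = {I. semiring_ideal R I \<and> J \<subseteq> I \<and> I \<inter> S = {}}"
  have "\<exists>M\<in>\<A>. \<forall>I\<in>\<A>. M \<subseteq> I \<longrightarrow> I = M"
  proof (rule subset_Zorn_nonempty)
    show "\<A> \<noteq> {}" using J disj by (auto simp: \<A>_def)
  next
    fix \<C> assume ne: "\<C> \<noteq> {}" and ch: "subset.chain \<A> \<C>"
    have C: "semiring_ideal R I" "J \<subseteq> I" "I \<inter> S = {}" if "I \<in> \<C>" for I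
      using ch that by (auto simp: \<A>_def subset_chain_def)
    have "x \<oplus> y \<in> \<Union>\<C>" if xy: "x \<in> \<Union>\<C>" "y \<in> \<Union>\<C>" for x y
    proof -
      obtain I I' where I: "I \<in> \<C>" "x \<in> I" "I' \<in> \<C>" "y \<in> I'" using xy by blast
      then consider "I \<subseteq> I'" | "I' \<subseteq> I" using ch unfolding subset_chain_def by blast
      then show ?thesis
        using I semiring_idealD(3)[OF C(1)[OF I(1)]] semiring_idealD(3)[OF C(1)[OF I(3)]]
        by cases blast+
    qed
    moreover have "\<Union>\<C> \<subseteq> carrier R" using semiring_idealD(1)[OF C(1)] by blast
    moreover have "\<zero> \<in> \<Union>\<C>" using semiring_idealD(2)[OF C(1)] ne by blast
    moreover have "a \<otimes> x \<in> \<Union>\<C>" if "a \<in> carrier R" "x \<in> \<Union>\<C>" for a x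
      using semiring_idealD(4)[OF C(1)] that by blast
    ultimately have "semiring_ideal R (\<Union>\<C>)" by (simp add: semiring_ideal_def)
    moreover have "J \<subseteq> \<Union>\<C>" "\<Union>\<C> \<inter> S = {}" using C ne by blast+
    ultimately show "\<Union>\<C> \<in> \<A>" by (simp add: \<A>_def)
  qed
  then obtain M where M: "semiring_ideal R M" "J \<subseteq> M" "M \<inter> S = {}"
    and max: "\<And>I. I \<in> \<A> \<Longrightarrow> M \<subseteq> I \<Longrightarrow> I = M" by (auto simp: \<A>_def)
  note D = semiring_idealD[OF M(1)]
  have meet: "\<exists>i\<in>M. \<exists>r\<in>carrier R. i \<oplus> r \<otimes> a \<in> S" if a: "a \<in> carrier R" "a \<notin> M" for a
  proof (rule ccontr)
    assume no: "\<not> ?thesis"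
    let ?I = "{i \<oplus> r \<otimes> a | i r. i \<in> M \<and> r \<in> carrier R}"
    have "x = x \<oplus> \<zero> \<otimes> a" if "x \<in> M" for x using that a D(1) by (auto simp: subset_iff)
    then have "M \<subseteq> ?I" by blast
    moreover from this have "?I \<in> \<A>"
      using ideal_adjoin[OF M(1) a(1)] M(2) no by (auto simp: \<A>_def)
    ultimately have "?I = M" using max by blast
    moreover have "a = \<zero> \<oplus> \<one> \<otimes> a" using a by simp
    then have "a \<in> ?I" using D(2) by blast
    ultimately show False using a by simp
  qed
  have "a \<in> M \<or> b \<in> M" if ab: "a \<in> carrier R" "b \<in> carrier R" "a \<otimes> b \<in> M" for a b
  proof (rule ccontr)
    assume "\<not> ?thesis"
    then obtain i r j t where *: "i \<in> M" "r \<in> carrier R" "i \<oplus> r \<otimes> a \<in> S"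
      "j \<in> M" "t \<in> carrier R" "j \<oplus> t \<otimes> b \<in> S" using meet ab by meson
    have ij: "i \<in> carrier R" "j \<in> carrier R" using * D(1) by auto
    have "(i \<oplus> r \<otimes> a) \<otimes> (j \<oplus> t \<otimes> b) = (j \<oplus> t \<otimes> b) \<otimes> i \<oplus> ((r \<otimes> a) \<otimes> j \<oplus> (r \<otimes> t) \<otimes> (a \<otimes> b))"
      using ij * ab by (simp add: l_distr r_distr m_ac a_ac)
    moreover have "(j \<oplus> t \<otimes> b) \<otimes> i \<in> M" "(r \<otimes> a) \<otimes> j \<in> M" "(r \<otimes> t) \<otimes> (a \<otimes> b) \<in> M"
      using ij * ab by (auto intro!: D(4))
    then have "(j \<oplus> t \<otimes> b) \<otimes> i \<oplus> ((r \<otimes> a) \<otimes> j \<oplus> (r \<otimes> t) \<otimes> (a \<otimes> b)) \<in> M"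
      by (intro D(3))
    ultimately show False using submonoid.m_closed[OF S *(3,6)] M(3) by auto
  qed
  moreover have "M \<noteq> carrier R"
    using submonoid.one_closed[OF S] M(3) by auto
  ultimately have "M \<in> Spec R" using M(1) by (auto simp: Spec_def semiring_prime_def)
  then show ?thesis using M by blast
qed

text \<open>The bridge from points to equations: if no power of \<open>a\<close> lies in \<open>J\<close>, some prime ideal contains
  \<open>J\<close> and avoids the powers of \<open>a\<close>, hence is a point of \<open>D(a)\<close> at which all of \<open>J\<close> vanishes.\<close>

lemma power_in_ideal:
  assumes J: "semiring_ideal R J" and a: "a \<in> carrier R"
    and cover: "\<And>P. P \<in> principal_open R a \<Longrightarrow> \<exists>e\<in>J. e \<notin> P"
  shows "\<exists>n::nat. a [^] n \<in> J"
proof (rule ccontr)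
  assume "\<not> ?thesis"
  then have "J \<inter> {a [^] n | n::nat. True} = {}" by auto
  then obtain P where P: "P \<in> Spec R" "J \<subseteq> P" "P \<inter> {a [^] n | n::nat. True} = {}"
    using exists_prime_avoiding[OF J submonoid_powers[OF a]] by blast
  have "a [^] (1::nat) \<in> {a [^] n | n::nat. True}" by blast
  then have "a \<notin> P" using P(3) a by auto
  then show False using P cover by (auto simp: principal_open_def)
qed

lemma principal_open_mult:
  "a \<in> carrier R \<Longrightarrow> b \<in> carrier R \<Longrightarrow>
    principal_open R (a \<otimes> b) = principal_open R a \<inter> principal_open R b"
  by (auto simp: principal_open_def prime_mult_iff)

lemma principal_open_one: "principal_open R \<one> = Spec R"
  by (auto simp: principal_open_def one_notin_prime)

lemma openin_principal_open: "a \<in> carrier R \<Longrightarrow> openin (zariski R) (principal_open R a)"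
  by (auto simp: openin_zariski principal_open_def zero_locus_def intro!: exI[of _ "{a}"])

lemma openin_Spec: "openin (zariski R) (Spec R)"
  using openin_principal_open[of \<one>] by (simp add: principal_open_one)

lemma openin_subset_Spec: "openin (zariski R) U \<Longrightarrow> U \<subseteq> Spec R"
  by (auto simp: openin_zariski)

lemma topspace_zariski: "topspace (zariski R) = Spec R"
  using openin_Spec openin_subset_Spec[OF openin_topspace] openin_subset by blast

lemma principal_open_basis:
  assumes "openin (zariski R) U" "P \<in> U"
  shows "\<exists>b\<in>carrier R. P \<in> principal_open R b \<and> principal_open R b \<subseteq> U"
  using assms by (auto simp: openin_zariski principal_open_def zero_locus_def subset_iff)

lemma principal_within_cover:
  "openin (zariski R) U \<Longrightarrow> (\<Union>b\<in>principal_within R U. principal_open R b) = U"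
  using principal_open_basis[of U] unfolding principal_within_def by blast

lemma submonoid_denom:
  assumes "openin (zariski R) U" shows "submonoid (denom R U) R"
  using openin_subset_Spec[OF assms]
  by unfold_locales (auto simp: denom_def principal_open_mult principal_open_one)

lemma denom_mono: "V \<subseteq> U \<Longrightarrow> denom R U \<subseteq> denom R V"
  by (auto simp: denom_def)

lemma denom_subset_prime_compl: "P \<in> U \<Longrightarrow> denom R U \<subseteq> carrier R - P"
  by (auto simp: denom_def principal_open_def)

text \<open>One direction is \<open>power_in_ideal\<close> for the ideal generated by \<open>b\<close>.\<close>

lemma denom_principal_open_iff:
  assumes a: "a \<in> carrier R"
  shows "b \<in> denom R (principal_open R a) \<longleftrightarrow>
    b \<in> carrier R \<and> (\<exists>n::nat. \<exists>c\<in>carrier R. a [^] n = c \<otimes> b)"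
proof
  assume b: "b \<in> denom R (principal_open R a)"
  then have bc: "b \<in> carrier R" by (simp add: denom_def)
  have "semiring_ideal R {c \<otimes> b | c. c \<in> carrier R}"
    unfolding semiring_ideal_def
  proof (intro conjI ballI)
    show "{c \<otimes> b | c. c \<in> carrier R} \<subseteq> carrier R" using bc by auto
    have "\<zero> = \<zero> \<otimes> b" using bc by simp
    then show "\<zero> \<in> {c \<otimes> b | c. c \<in> carrier R}" by blast
  next
    fix x y assume "x \<in> {c \<otimes> b | c. c \<in> carrier R}" "y \<in> {c \<otimes> b | c. c \<in> carrier R}"
    then obtain c d where *: "x = c \<otimes> b" "y = d \<otimes> b" "c \<in> carrier R" "d \<in> carrier R" by blast
    then have "x \<oplus> y = (c \<oplus> d) \<otimes> b" using bc by (simp add: l_distr)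
    then show "x \<oplus> y \<in> {c \<otimes> b | c. c \<in> carrier R}" using * by blast
  next
    fix x y assume "x \<in> carrier R" "y \<in> {c \<otimes> b | c. c \<in> carrier R}"
    then obtain d where *: "y = d \<otimes> b" "d \<in> carrier R" "x \<in> carrier R" by blast
    then have "x \<otimes> y = (x \<otimes> d) \<otimes> b" using bc by (simp add: m_assoc)
    then show "x \<otimes> y \<in> {c \<otimes> b | c. c \<in> carrier R}" using * by blast
  qed
  moreover have "b = \<one> \<otimes> b" using bc by simp
  then have "b \<in> {c \<otimes> b | c. c \<in> carrier R}" by blast
  ultimately have "\<exists>n::nat. a [^] n \<in> {c \<otimes> b | c. c \<in> carrier R}"
    using b by (intro power_in_ideal[OF _ a]) (auto simp: denom_def principal_open_def)
  then show "b \<in> carrier R \<and> (\<exists>n::nat. \<exists>c\<in>carrier R. a [^] n = c \<otimes> b)" using bc by auto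
next
  assume "b \<in> carrier R \<and> (\<exists>n::nat. \<exists>c\<in>carrier R. a [^] n = c \<otimes> b)"
  then obtain n :: nat and c where *: "b \<in> carrier R" "c \<in> carrier R" "a [^] n = c \<otimes> b" by blast
  have "b \<notin> P" if "P \<in> Spec R" "a \<notin> P" for P
    using that * a prime_power_iff[of P a n] prime_mult_iff[of P c b] by auto
  then show "b \<in> denom R (principal_open R a)" using * by (auto simp: denom_def principal_open_def)
qed

text \<open>Localizing at the powers of \<open>a\<close> or at the larger set of all denominators that are
  admissible on \<open>D(a)\<close> gives the same semiring, since each such denominator divides a power
  of \<open>a\<close>.\<close>

lemma loc_elem_iso_pre_struct:
  assumes a: "a \<in> carrier R"
  shows "loc_map R (denom R (principal_open R a))
    \<in> semiring_iso (loc_elem R a) (sect (pre_struct R) (principal_open R a))"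
proof -
  let ?S = "{a [^] n | n::nat. True}" and ?T = "denom R (principal_open R a)"
  have S: "submonoid ?S R" and T: "submonoid ?T R"
    using submonoid_powers submonoid_denom openin_principal_open a by auto
  have pow: "a [^] n \<in> ?T" for n :: nat
    using a by (auto simp: denom_def principal_open_def prime_power_iff)
  then have ST: "?S \<subseteq> ?T" by blast
  have S': "s \<in> carrier R" if "s \<in> ?S" for s using submonoid.subset[OF S] that by blast
  have T': "s \<in> carrier R" if "s \<in> ?T" for s using submonoid.subset[OF T] that by blast
  note lm = loc_map_fraction[OF S T ST]
  have inj: "fraction R ?S b s = fraction R ?S c t"
    if eq: "fraction R ?T b s = fraction R ?T c t"
      and c: "b \<in> carrier R" "c \<in> carrier R" "s \<in> ?S" "t \<in> ?S" for b c s t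
  proof -
    obtain u where u: "u \<in> ?T" "b \<otimes> t \<otimes> u = c \<otimes> s \<otimes> u"
      using eq c ST by (subst (asm) fraction_eq_iff[OF T]) auto
    then obtain n :: nat and d where d: "d \<in> carrier R" "a [^] n = d \<otimes> u"
      using denom_principal_open_iff[OF a] by blast
    have "b \<otimes> t \<otimes> a [^] n = (b \<otimes> t \<otimes> u) \<otimes> d"
      using c d T'[OF u(1)] S'[OF c(4)] by (simp add: m_ac)
    also have "\<dots> = c \<otimes> s \<otimes> a [^] n"
      unfolding u(2) using c d T'[OF u(1)] S'[OF c(3)] by (simp add: m_ac)
    finally show ?thesis using c by (subst fraction_eq_iff[OF S]) auto
  qed
  have sur: "\<exists>c s. c \<in> carrier R \<and> s \<in> ?S \<and> fraction R ?T b t = fraction R ?T c s"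
    if b: "b \<in> carrier R" "t \<in> ?T" for b t
  proof -
    obtain n :: nat and d where d: "d \<in> carrier R" "a [^] n = d \<otimes> t"
      using denom_principal_open_iff[OF a] b by blast
    have "b \<otimes> a [^] n = (b \<otimes> d) \<otimes> t" using b d T'[OF b(2)] by (simp add: m_ac)
    then have "fraction R ?T b t = fraction R ?T (b \<otimes> d) (a [^] n)"
      using fraction_eq_iff[OF T b(1) closed_ops(2)[OF b(1) d(1)] b(2) pow]
        submonoid.one_closed[OF T] by metis
    then show ?thesis using b d by blast
  qed
  show ?thesis
    unfolding loc_elem_def pre_struct_def presheaf.simps
  proof (rule semiring_isoI)
    show "inj_on (loc_map R ?T) (carrier (localization R ?S))"
    proof (rule inj_onI)
      fix x y assume "x \<in> carrier (localization R ?S)" "y \<in> carrier (localization R ?S)"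
        and eq: "loc_map R ?T x = loc_map R ?T y"
      then obtain b s c t where xy: "x = fraction R ?S b s" "y = fraction R ?S c t"
        and c: "b \<in> carrier R" "c \<in> carrier R" "s \<in> ?S" "t \<in> ?S"
        unfolding localization_simps(1) by blast
      show "x = y" using eq inj[OF _ c] unfolding xy lm[OF c(1,3)] lm[OF c(2,4)] by blast
    qed
    show "carrier (localization R ?T) \<subseteq> loc_map R ?T ` carrier (localization R ?S)"
    proof
      fix x assume "x \<in> carrier (localization R ?T)"
      then obtain b t where "x = fraction R ?T b t" "b \<in> carrier R" "t \<in> ?T"
        by (auto simp: localization_simps)
      then obtain c s where "c \<in> carrier R" "s \<in> ?S" "x = loc_map R ?T (fraction R ?S c s)"
        using sur lm by metis
      then show "x \<in> loc_map R ?T ` carrier (localization R ?S)"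
        by (auto simp: localization_simps)
    qed
  qed (rule loc_map_hom[OF S T ST])
qed

lemma pre_struct_carrier:
  "carrier (sect (pre_struct R) U) = {fraction R (denom R U) a s | a s. a \<in> carrier R \<and> s \<in> denom R U}"
  by (simp add: pre_struct_def localization_simps)

lemma pre_struct_restr:
  assumes "openin (zariski R) U" "openin (zariski R) V" "V \<subseteq> U" "a \<in> carrier R" "s \<in> denom R U"
  shows "restr (pre_struct R) U V (fraction R (denom R U) a s) = fraction R (denom R V) a s"
  using assms by (simp add: pre_struct_def loc_map_fraction submonoid_denom denom_mono)

lemma loc_map_prime:
  assumes "openin (zariski R) U" "P \<in> U" "a \<in> carrier R" "s \<in> denom R U"
  shows "loc_map R (carrier R - P) (fraction R (denom R U) a s) = fraction R (carrier R - P) a s"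
  using assms openin_subset_Spec[of U]
  by (intro loc_map_fraction submonoid_denom submonoid_prime_compl denom_subset_prime_compl) auto

lemma loc_map_prime_hom:
  assumes "openin (zariski R) U" "P \<in> U"
  shows "loc_map R (carrier R - P) \<in> semiring_hom (sect (pre_struct R) U) (loc_prime R P)"
  unfolding pre_struct_def loc_prime_def presheaf.simps
  using assms openin_subset_Spec[of U]
  by (intro loc_map_hom submonoid_denom submonoid_prime_compl denom_subset_prime_compl) auto

lemma semiring_presheaf_pre_struct: "semiring_presheaf (zariski R) (pre_struct R)"
proof (rule semiring_presheaf.intro)
  show "csemiring (sect (pre_struct R) U)" if "openin (zariski R) U" for U
    using that by (simp add: pre_struct_def csemiring_localization submonoid_denom)
  show "restr (pre_struct R) U V \<in> semiring_hom (sect (pre_struct R) U) (sect (pre_struct R) V)"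
    if "openin (zariski R) U" "openin (zariski R) V" "V \<subseteq> U" for U V
    using that by (simp add: pre_struct_def loc_map_hom submonoid_denom denom_mono)
  show "restr (pre_struct R) U U s = s"
    if "openin (zariski R) U" "s \<in> carrier (sect (pre_struct R) U)" for U s
    using that by (auto simp: pre_struct_carrier pre_struct_restr)
  show "restr (pre_struct R) V W (restr (pre_struct R) U V s) = restr (pre_struct R) U W s"
    if "openin (zariski R) U" "openin (zariski R) V" "openin (zariski R) W" "W \<subseteq> V" "V \<subseteq> U"
      "s \<in> carrier (sect (pre_struct R) U)" for U V W s
    using that denom_mono[of V U] by (auto simp: pre_struct_carrier pre_struct_restr subset_iff)
qed


section \<open>The localization at a prime is local\<close>

lemma unique_maximal_ideal:
  assumes "semiring_ideal R M" "M \<noteq> carrier R"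
    and sub: "\<And>J. semiring_ideal R J \<Longrightarrow> J \<noteq> carrier R \<Longrightarrow> J \<subseteq> M"
  shows "\<exists>!M. semiring_maximal R M"
proof (rule ex1I)
  show max: "semiring_maximal R M" using assms by (auto simp: semiring_maximal_def)
  show "N = M" if "semiring_maximal R N" for N
    using that assms(1,2) sub[of N] by (auto simp: semiring_maximal_def)
qed

text \<open>A fraction \<open>a/s\<close> with \<open>a \<notin> P\<close> is a unit, so every proper ideal lies in the ideal of the fractions
  with numerator in \<open>P\<close>. That ideal is proper because having the numerator in \<open>P\<close> does not depend on
  the representative.\<close>

lemma local_semiring_loc_prime:
  assumes P: "P \<in> Spec R"
  shows "local_semiring (loc_prime R P)"
proof -
  let ?S = "carrier R - P"
  let ?L = "loc_prime R P"
  let ?M = "{fraction R ?S a s | a s. a \<in> P \<and> s \<in> ?S}"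
  note S = submonoid_prime_compl[OF P]
  note PD = semiring_idealD[OF prime_ideal[OF P]]
  interpret L: csemiring ?L by (rule csemiring_loc_prime[OF P])
  have Lc: "carrier ?L = {fraction R ?S a s | a s. a \<in> carrier R \<and> s \<in> ?S}"
    "\<one>\<^bsub>?L\<^esub> = fraction R ?S \<one> \<one>" "\<zero>\<^bsub>?L\<^esub> = fraction R ?S \<zero> \<one>"
    by (simp_all add: loc_prime_def localization_simps)
  note Lm = fraction_mult[OF S, folded loc_prime_def]
  note La = fraction_add[OF S, folded loc_prime_def]
  have in_M: "fraction R ?S a s \<in> ?M \<longleftrightarrow> a \<in> P" if as: "a \<in> carrier R" "s \<in> ?S" for a s
  proof
    assume "fraction R ?S a s \<in> ?M"
    then obtain b t where bt: "fraction R ?S a s = fraction R ?S b t" "b \<in> P" "t \<in> ?S" by auto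
    have bc: "b \<in> carrier R" using bt PD(1) by auto
    then obtain u where u: "u \<in> ?S" "a \<otimes> t \<otimes> u = b \<otimes> s \<otimes> u"
      using fraction_eq_iff[OF S as(1) bc as(2) bt(3)] bt(1) by blast
    have "b \<otimes> s \<otimes> u \<in> P" using u bc as bt by (auto simp: prime_mult_iff[OF P])
    then show "a \<in> P" using u(1) as bt(3) unfolding u(2)[symmetric] by (auto simp: prime_mult_iff[OF P])
  qed (use as in blast)
  have "semiring_ideal ?L ?M"
    unfolding semiring_ideal_def
  proof (intro conjI ballI)
    show "?M \<subseteq> carrier ?L" using PD(1) unfolding Lc(1) by blast
    show "\<zero>\<^bsub>?L\<^esub> \<in> ?M" using PD(2) submonoid.one_closed[OF S] unfolding Lc(3) by blast
  next
    fix x y assume "x \<in> ?M" "y \<in> ?M"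
    then obtain a s b t where *: "x = fraction R ?S a s" "y = fraction R ?S b t"
      "a \<in> P" "s \<in> ?S" "b \<in> P" "t \<in> ?S" by blast
    have ab: "a \<in> carrier R" "b \<in> carrier R" using * PD(1) by auto
    have "a \<otimes> t \<oplus> b \<otimes> s \<in> P" using * ab by (intro PD(3)) (auto simp: prime_mult_iff[OF P])
    then show "x \<oplus>\<^bsub>?L\<^esub> y \<in> ?M"
      unfolding *(1,2) La[OF ab *(4,6)] using submonoid.m_closed[OF S *(4,6)] by blast
  next
    fix x y assume "x \<in> carrier ?L" "y \<in> ?M"
    then obtain a s b t where *: "x = fraction R ?S a s" "y = fraction R ?S b t"
      "a \<in> carrier R" "s \<in> ?S" "b \<in> P" "t \<in> ?S" unfolding Lc(1) by blast
    have b: "b \<in> carrier R" using * PD(1) by auto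
    show "x \<otimes>\<^bsub>?L\<^esub> y \<in> ?M"
      unfolding *(1,2) Lm[OF *(3) b *(4,6)] using submonoid.m_closed[OF S *(4,6)] PD(4)[OF *(3,5)] by blast
  qed
  moreover have "?M \<noteq> carrier ?L"
    using in_M[OF closed_ops(4) submonoid.one_closed[OF S]] one_notin_prime[OF P] L.closed_ops(4)
    unfolding Lc(2) by blast
  moreover have sub: "J \<subseteq> ?M" if J: "semiring_ideal ?L J" "J \<noteq> carrier ?L" for J
  proof
    fix x assume x: "x \<in> J"
    then obtain a s where as: "x = fraction R ?S a s" "a \<in> carrier R" "s \<in> ?S"
      using L.semiring_idealD(1)[OF J(1)] unfolding Lc(1) by blast
    show "x \<in> ?M"
    proof (rule ccontr)
      assume "x \<notin> ?M"
      then have a: "a \<in> ?S" using in_M as by blast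
      \<comment> \<open>then \<open>x\<close> is a unit with inverse \<open>s/a\<close>\<close>
      have "fraction R ?S s a \<otimes>\<^bsub>?L\<^esub> x = \<one>\<^bsub>?L\<^esub>"
        unfolding as(1) Lc(2) using as a submonoid.one_closed[OF S] submonoid.m_closed[OF S]
        by (subst Lm) (auto simp: fraction_eq_iff[OF S] m_ac)
      moreover have "fraction R ?S s a \<in> carrier ?L" using as a unfolding Lc(1) by blast
      ultimately have "\<one>\<^bsub>?L\<^esub> \<in> J" using L.semiring_idealD(4)[OF J(1)] x by metis
      then have "y \<in> J" if "y \<in> carrier ?L" for y
        using L.semiring_idealD(4)[OF J(1) that] that by fastforce
      then show False using J(2) L.semiring_idealD(1)[OF J(1)] by blast
    qed
  qed
  ultimately have "\<exists>!M. semiring_maximal ?L M" by (rule L.unique_maximal_ideal)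
  then show ?thesis using csemiring_loc_prime[OF P] by (simp add: local_semiring_def)
qed

end

section \<open>Isomorphisms of presheaves and models of stalks\<close>

text \<open>The condition in \<open>presheaf_isomorphic\<close> with the isomorphism named, so that it can be inverted,
  composed and compared with the natural maps.\<close>

definition presheaf_iso ::
    "'p topology \<Rightarrow> ('p, 'b) presheaf \<Rightarrow> ('p, 'c) presheaf \<Rightarrow> ('p set \<Rightarrow> 'b \<Rightarrow> 'c) \<Rightarrow> bool" where
  "presheaf_iso X F G \<phi> \<longleftrightarrow>
     (\<forall>U. openin X U \<longrightarrow> \<phi> U \<in> semiring_iso (sect F U) (sect G U)) \<and>
     (\<forall>U V. openin X U \<and> openin X V \<and> V \<subseteq> U \<longrightarrow>
        (\<forall>s\<in>carrier (sect F U). restr G U V (\<phi> U s) = \<phi> V (restr F U V s)))"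

lemma presheaf_isomorphic_iff: "presheaf_isomorphic X F G \<longleftrightarrow> (\<exists>\<phi>. presheaf_iso X F G \<phi>)"
  by (simp add: presheaf_isomorphic_def presheaf_iso_def)

lemma presheaf_isoD:
  assumes "presheaf_iso X F G \<phi>"
  shows "openin X U \<Longrightarrow> \<phi> U \<in> semiring_iso (sect F U) (sect G U)"
    and "openin X U \<Longrightarrow> openin X V \<Longrightarrow> V \<subseteq> U \<Longrightarrow> s \<in> carrier (sect F U) \<Longrightarrow>
      restr G U V (\<phi> U s) = \<phi> V (restr F U V s)"
  using assms by (auto simp: presheaf_iso_def)

lemma presheaf_iso_comp:
  assumes "presheaf_iso X F G \<phi>" "presheaf_iso X G H \<psi>"
  shows "presheaf_iso X F H (\<lambda>U s. \<psi> U (\<phi> U s))"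
  using semiring_iso_comp[OF presheaf_isoD(1)[OF assms(1)] presheaf_isoD(1)[OF assms(2)]]
    presheaf_isoD(2)[OF assms(1)] presheaf_isoD(2)[OF assms(2)]
    semiring_homD(1)[OF semiring_isoD(1)[OF presheaf_isoD(1)[OF assms(1)]]]
  unfolding presheaf_iso_def by metis

context semiring_presheaf
begin

lemma restr_closed:
  "openin X U \<Longrightarrow> openin X V \<Longrightarrow> V \<subseteq> U \<Longrightarrow> s \<in> carrier (sect F U) \<Longrightarrow>
    restr F U V s \<in> carrier (sect F V)"
  using semiring_homD(1)[OF restr_hom] by blast

context
  fixes G :: "('p, 'c) presheaf" and \<phi>
  assumes iso: "presheaf_iso X F G \<phi>"
begin

lemma iso_hom: "openin X U \<Longrightarrow> \<phi> U \<in> semiring_hom (sect F U) (sect G U)"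
  using semiring_isoD(1)[OF presheaf_isoD(1)[OF iso]] .

lemma iso_eq_iff:
  "openin X U \<Longrightarrow> s \<in> carrier (sect F U) \<Longrightarrow> t \<in> carrier (sect F U) \<Longrightarrow> \<phi> U s = \<phi> U t \<longleftrightarrow> s = t"
  using semiring_isoD(2)[OF presheaf_isoD(1)[OF iso]] by (blast dest: inj_onD)

lemma iso_rep:
  assumes "openin X U" "t \<in> carrier (sect G U)"
  obtains s where "s \<in> carrier (sect F U)" "t = \<phi> U s"
  using assms semiring_isoD(3)[OF presheaf_isoD(1)[OF iso]] by blast

lemma iso_inv:
  assumes "openin X U" "s \<in> carrier (sect F U)"
  shows "inv_into (carrier (sect F U)) (\<phi> U) (\<phi> U s) = s"
  using inv_into_f_f[OF semiring_isoD(2)[OF presheaf_isoD(1)[OF iso]]] assms by blast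

lemma presheaf_iso_inverse:
  "presheaf_iso X G F (\<lambda>U. inv_into (carrier (sect F U)) (\<phi> U))"
  unfolding presheaf_iso_def
proof (intro conjI allI impI ballI)
  show "inv_into (carrier (sect F U)) (\<phi> U) \<in> semiring_iso (sect G U) (sect F U)"
    if "openin X U" for U
    using csemiring.semiring_iso_inverse[OF csemiring_sect[OF that] presheaf_isoD(1)[OF iso that]] .
  fix U V t assume UV: "openin X U \<and> openin X V \<and> V \<subseteq> U" and t: "t \<in> carrier (sect G U)"
  then obtain s where "s \<in> carrier (sect F U)" "t = \<phi> U s" by (meson iso_rep)
  then show "restr F U V (inv_into (carrier (sect F U)) (\<phi> U) t) =
      inv_into (carrier (sect F V)) (\<phi> V) (restr G U V t)"
    using UV presheaf_isoD(2)[OF iso] by (simp add: iso_inv restr_closed)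
qed

text \<open>Since \<open>\<phi>\<close> is bijective and commutes with restriction, every operation and restriction of \<open>G\<close> is
  that of \<open>F\<close> conjugated with \<open>\<phi>\<close>.\<close>

lemma presheaf_transport: "semiring_presheaf X G"
proof (rule semiring_presheaf.intro)
  show "csemiring (sect G U)" if "openin X U" for U
    using csemiring.csemiring_iso_image[OF csemiring_sect[OF that] presheaf_isoD(1)[OF iso that]] .
  show "restr G U V \<in> semiring_hom (sect G U) (sect G V)"
    if o: "openin X U" "openin X V" "V \<subseteq> U" for U V
  proof (rule csemiring.semiring_hom_cong)
    show "csemiring (sect G U)"
      using csemiring.csemiring_iso_image[OF csemiring_sect[OF o(1)] presheaf_isoD(1)[OF iso o(1)]] .
    show "(\<lambda>t. \<phi> V (restr F U V (inv_into (carrier (sect F U)) (\<phi> U) t)))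
        \<in> semiring_hom (sect G U) (sect G V)"
      using o presheaf_isoD(1)[OF presheaf_iso_inverse]
      by (intro semiring_hom_comp[OF _ iso_hom] semiring_hom_comp[OF _ restr_hom] semiring_isoD(1)) auto
    fix t assume "t \<in> carrier (sect G U)"
    then obtain s where "s \<in> carrier (sect F U)" "t = \<phi> U s" using o by (meson iso_rep)
    then show "restr G U V t = \<phi> V (restr F U V (inv_into (carrier (sect F U)) (\<phi> U) t))"
      using o presheaf_isoD(2)[OF iso] by (simp add: iso_inv)
  qed
  show "restr G U U t = t" if t: "openin X U" "t \<in> carrier (sect G U)" for U t
  proof -
    obtain s where "s \<in> carrier (sect F U)" "t = \<phi> U s" using t by (meson iso_rep)
    then show ?thesis using t presheaf_isoD(2)[OF iso] by (simp add: restr_id)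
  qed
  show "restr G V W (restr G U V t) = restr G U W t"
    if o: "openin X U" "openin X V" "openin X W" "W \<subseteq> V" "V \<subseteq> U" and t: "t \<in> carrier (sect G U)"
    for U V W t
  proof -
    obtain s where s: "s \<in> carrier (sect F U)" "t = \<phi> U s" using o t by (meson iso_rep)
    moreover have "W \<subseteq> U" using o by blast
    ultimately show ?thesis
      using o presheaf_isoD(2)[OF iso] restr_closed[OF o(1,2,5) s(1)] restr_comp[OF o s(1)] by simp
  qed
qed

end

end

lemma (in semiring_sheaf) sheaf_transport:
  assumes iso: "presheaf_iso X F G \<phi>"
  shows "semiring_sheaf X G"
proof -
  note nat = presheaf_isoD(2)[OF iso]
  have openU: "openin X (\<Union>\<U>)" if "\<And>V. V \<in> \<U> \<Longrightarrow> openin X V" for \<U> using that by blast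
  show ?thesis
  proof (rule semiring_sheaf.intro[OF presheaf_transport[OF iso]], rule semiring_sheaf_axioms.intro)
    fix \<U> s t
    assume o: "\<And>V. V \<in> \<U> \<Longrightarrow> openin X V"
      and st: "s \<in> carrier (sect G (\<Union>\<U>))" "t \<in> carrier (sect G (\<Union>\<U>))"
      and eq: "\<And>V. V \<in> \<U> \<Longrightarrow> restr G (\<Union>\<U>) V s = restr G (\<Union>\<U>) V t"
    obtain s' t' where s': "s' \<in> carrier (sect F (\<Union>\<U>))" "s = \<phi> (\<Union>\<U>) s'"
      and t': "t' \<in> carrier (sect F (\<Union>\<U>))" "t = \<phi> (\<Union>\<U>) t'"
      using st openU[OF o] by (meson iso_rep[OF iso])
    have "restr F (\<Union>\<U>) V s' = restr F (\<Union>\<U>) V t'" if V: "V \<in> \<U>" for V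
    proof -
      have sub: "V \<subseteq> \<Union>\<U>" using V by blast
      note r = openU[OF o] o[OF V] sub
      have "\<phi> V (restr F (\<Union>\<U>) V s') = \<phi> V (restr F (\<Union>\<U>) V t')"
        using eq[OF V] s' t' nat[OF r] by simp
      then show ?thesis using iso_eq_iff[OF iso] o[OF V] restr_closed[OF r] s' t' by blast
    qed
    then have "s' = t'" using locality[of \<U> s' t'] o s' t' by blast
    then show "s = t" using s' t' by simp
  next
    fix \<U> \<sigma>
    assume o: "\<And>V. V \<in> \<U> \<Longrightarrow> openin X V"
      and \<sigma>: "\<And>V. V \<in> \<U> \<Longrightarrow> \<sigma> V \<in> carrier (sect G V)"
      and eq: "\<And>V W. V \<in> \<U> \<Longrightarrow> W \<in> \<U> \<Longrightarrow> restr G V (V \<inter> W) (\<sigma> V) = restr G W (V \<inter> W) (\<sigma> W)"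
    have "\<exists>s. s \<in> carrier (sect F V) \<and> \<sigma> V = \<phi> V s" if "V \<in> \<U>" for V
      using \<sigma> o that by (meson iso_rep[OF iso])
    then obtain \<tau> where \<tau>: "\<And>V. V \<in> \<U> \<Longrightarrow> \<tau> V \<in> carrier (sect F V)" "\<And>V. V \<in> \<U> \<Longrightarrow> \<sigma> V = \<phi> V (\<tau> V)"
      by metis
    have "restr F V (V \<inter> W) (\<tau> V) = restr F W (V \<inter> W) (\<tau> W)" if VW: "V \<in> \<U>" "W \<in> \<U>" for V W
    proof -
      have i: "openin X (V \<inter> W)" using o VW by blast
      have "\<phi> (V \<inter> W) (restr F V (V \<inter> W) (\<tau> V)) = \<phi> (V \<inter> W) (restr F W (V \<inter> W) (\<tau> W))"
        using eq[OF VW] nat[OF o[OF VW(1)] i] nat[OF o[OF VW(2)] i] \<tau> VW by simp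
      then show ?thesis
        using iso_eq_iff[OF iso i] restr_closed o i VW \<tau>(1) by (meson inf.cobounded1 inf.cobounded2)
    qed
    then obtain s where s: "s \<in> carrier (sect F (\<Union>\<U>))" "\<forall>V\<in>\<U>. restr F (\<Union>\<U>) V s = \<tau> V"
      using gluing[of \<U> \<tau>] o \<tau>(1) by blast
    have "restr G (\<Union>\<U>) V (\<phi> (\<Union>\<U>) s) = \<sigma> V" if V: "V \<in> \<U>" for V
    proof -
      have "V \<subseteq> \<Union>\<U>" using V by blast
      then show ?thesis using nat[OF openU[OF o] o[OF V] _ s(1)] s(2) \<tau>(2) V by simp
    qed
    then show "\<exists>s\<in>carrier (sect G (\<Union>\<U>)). \<forall>V\<in>\<U>. restr G (\<Union>\<U>) V s = \<sigma> V"
      using semiring_homD(1)[OF iso_hom[OF iso openU[OF o]] s(1)] by blast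
  qed
qed

text \<open>The stalk at \<open>p\<close> as a colimit, described through its target: a semiring \<open>K\<close> with compatible
  evaluations \<open>ev\<close> on the sections near \<open>p\<close>, which are jointly surjective and identify two sections only
  if these agree near \<open>p\<close>, is the stalk. All stalks in question are computed by exhibiting such
  evaluations into \<open>A\<^sub>P\<close>.\<close>

locale stalk_model = semiring_presheaf X F for X :: "'p topology" and F :: "('p, 'b) presheaf" +
  fixes K :: "'c ring" and p :: 'p and ev :: "'p set \<Rightarrow> 'b \<Rightarrow> 'c"
  assumes csemiring_K: "csemiring K"
    and point: "p \<in> topspace X"
    and ev_hom: "openin X U \<Longrightarrow> p \<in> U \<Longrightarrow> ev U \<in> semiring_hom (sect F U) K"
    and ev_restr: "openin X U \<Longrightarrow> openin X V \<Longrightarrow> p \<in> V \<Longrightarrow> V \<subseteq> U \<Longrightarrow> s \<in> carrier (sect F U) \<Longrightarrow>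
      ev V (restr F U V s) = ev U s"
    and ev_surj: "k \<in> carrier K \<Longrightarrow> \<exists>U s. openin X U \<and> p \<in> U \<and> s \<in> carrier (sect F U) \<and> ev U s = k"
    and ev_separated: "openin X U \<Longrightarrow> openin X V \<Longrightarrow> p \<in> U \<Longrightarrow> p \<in> V \<Longrightarrow>
      s \<in> carrier (sect F U) \<Longrightarrow> t \<in> carrier (sect F V) \<Longrightarrow> ev U s = ev V t \<Longrightarrow>
      \<exists>W. openin X W \<and> p \<in> W \<and> W \<subseteq> U \<inter> V \<and> restr F U W s = restr F V W t"
begin

text \<open>As two sections have equal values under \<open>ev\<close> exactly if they agree near \<open>p\<close>, a germ is a fibre of
  \<open>ev\<close>.\<close>

definition germ_of_value :: "'c \<Rightarrow> ('p set \<times> 'b) set" where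
  "germ_of_value k = {(V, t). openin X V \<and> p \<in> V \<and> t \<in> carrier (sect F V) \<and> ev V t = k}"

lemma germ_eq:
  assumes "openin X U" "p \<in> U" "s \<in> carrier (sect F U)"
  shows "germ X F p U s = germ_of_value (ev U s)"
proof -
  have "(\<exists>W. openin X W \<and> p \<in> W \<and> W \<subseteq> U \<inter> V \<and> restr F U W s = restr F V W t) \<longleftrightarrow> ev V t = ev U s"
    if V: "openin X V" "p \<in> V" "t \<in> carrier (sect F V)" for V t
  proof
    assume "\<exists>W. openin X W \<and> p \<in> W \<and> W \<subseteq> U \<inter> V \<and> restr F U W s = restr F V W t"
    then obtain W where "openin X W" "p \<in> W" "W \<subseteq> U" "W \<subseteq> V" "restr F U W s = restr F V W t"
      by blast
    then show "ev V t = ev U s" using ev_restr[of U W s] ev_restr[of V W t] assms V by simp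
  next
    assume "ev V t = ev U s"
    then show "\<exists>W. openin X W \<and> p \<in> W \<and> W \<subseteq> U \<inter> V \<and> restr F U W s = restr F V W t"
      using ev_separated[of U V s t] assms V by simp
  qed
  then show ?thesis unfolding germ_def germ_of_value_def by blast
qed

text \<open>Products and sums of germs are formed on \<open>U \<inter> V\<close>, where \<open>ev\<close> is a homomorphism compatible with
  restriction from \<open>U\<close> and from \<open>V\<close>.\<close>

lemma germ_of_value_iso: "germ_of_value \<in> semiring_iso K (stalk X F p)"
proof -
  interpret K: csemiring K by (rule csemiring_K)
  have rep: "\<exists>U s. (U, s) \<in> germ_of_value k" if "k \<in> carrier K" for k
    using ev_surj[OF that] by (auto simp: germ_of_value_def)
  have carr: "carrier (stalk X F p) = germ_of_value ` carrier K"
  proof (intro equalityI subsetI)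
    fix x assume "x \<in> carrier (stalk X F p)"
    then obtain U s where "openin X U" "p \<in> U" "s \<in> carrier (sect F U)" "x = germ X F p U s"
      by (auto simp: stalk_def)
    then show "x \<in> germ_of_value ` carrier K"
      using germ_eq semiring_homD(1)[OF ev_hom] by blast
  next
    fix x assume "x \<in> germ_of_value ` carrier K"
    then obtain k where "k \<in> carrier K" "x = germ_of_value k" by blast
    then obtain U s where "openin X U" "p \<in> U" "s \<in> carrier (sect F U)" "x = germ X F p U s"
      using ev_surj germ_eq by metis
    then show "x \<in> carrier (stalk X F p)" by (auto simp: stalk_def)
  qed
  have pair: "germ X F p (U \<inter> V) (restr F U (U \<inter> V) s \<otimes>\<^bsub>sect F (U \<inter> V)\<^esub> restr F V (U \<inter> V) t) =
        germ_of_value (k \<otimes>\<^bsub>K\<^esub> l)"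
      "germ X F p (U \<inter> V) (restr F U (U \<inter> V) s \<oplus>\<^bsub>sect F (U \<inter> V)\<^esub> restr F V (U \<inter> V) t) =
        germ_of_value (k \<oplus>\<^bsub>K\<^esub> l)"
    if kl: "(U, s) \<in> germ_of_value k" "(V, t) \<in> germ_of_value l" for k l U s V t
  proof -
    have *: "openin X U" "p \<in> U" "s \<in> carrier (sect F U)" "ev U s = k"
        "openin X V" "p \<in> V" "t \<in> carrier (sect F V)" "ev V t = l"
      using kl by (auto simp: germ_of_value_def)
    have o: "openin X (U \<inter> V)" "p \<in> U \<inter> V" using * by auto
    interpret I: csemiring "sect F (U \<inter> V)" by (rule csemiring_sect[OF o(1)])
    have c: "restr F U (U \<inter> V) s \<in> carrier (sect F (U \<inter> V))"
        "restr F V (U \<inter> V) t \<in> carrier (sect F (U \<inter> V))"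
      using * o by (auto intro!: restr_closed)
    have e: "ev (U \<inter> V) (restr F U (U \<inter> V) s) = k" "ev (U \<inter> V) (restr F V (U \<inter> V) t) = l"
      using * o ev_restr[of U "U \<inter> V" s] ev_restr[of V "U \<inter> V" t] by auto
    show "germ X F p (U \<inter> V) (restr F U (U \<inter> V) s \<otimes>\<^bsub>sect F (U \<inter> V)\<^esub> restr F V (U \<inter> V) t) =
        germ_of_value (k \<otimes>\<^bsub>K\<^esub> l)"
      "germ X F p (U \<inter> V) (restr F U (U \<inter> V) s \<oplus>\<^bsub>sect F (U \<inter> V)\<^esub> restr F V (U \<inter> V) t) =
        germ_of_value (k \<oplus>\<^bsub>K\<^esub> l)"
      using semiring_homD(2,3)[OF ev_hom[OF o] c] c e by (simp_all add: germ_eq[OF o])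
  qed
  have X: "openin X (topspace X)" by simp
  interpret T: csemiring "sect F (topspace X)" by (rule csemiring_sect[OF X])
  show ?thesis
  proof (rule semiring_isoI)
    show "inj_on germ_of_value (carrier K)"
    proof (rule inj_onI)
      fix k l assume "k \<in> carrier K" and eq: "germ_of_value k = germ_of_value l"
      then obtain U s where "(U, s) \<in> germ_of_value k" "(U, s) \<in> germ_of_value l"
        using rep by metis
      then show "k = l" by (simp add: germ_of_value_def)
    qed
    show "germ_of_value \<in> semiring_hom K (stalk X F p)"
    proof (rule semiring_homI)
      fix k l assume kl: "k \<in> carrier K" "l \<in> carrier K"
      then obtain U s V t where r: "(U, s) \<in> germ_of_value k" "(V, t) \<in> germ_of_value l"
        using rep by meson
      show "germ_of_value (k \<otimes>\<^bsub>K\<^esub> l) = germ_of_value k \<otimes>\<^bsub>stalk X F p\<^esub> germ_of_value l"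
        by (simp add: stalk_def) (rule UN_pairs_const[OF r, symmetric], rule pair)
      show "germ_of_value (k \<oplus>\<^bsub>K\<^esub> l) = germ_of_value k \<oplus>\<^bsub>stalk X F p\<^esub> germ_of_value l"
        by (simp add: stalk_def) (rule UN_pairs_const[OF r, symmetric], rule pair)
    next
      show "germ_of_value \<one>\<^bsub>K\<^esub> = \<one>\<^bsub>stalk X F p\<^esub>" "germ_of_value \<zero>\<^bsub>K\<^esub> = \<zero>\<^bsub>stalk X F p\<^esub>"
        using semiring_homD(4,5)[OF ev_hom[OF X point]] by (simp_all add: stalk_def germ_eq[OF X point])
    qed (use carr in blast)
  qed (simp add: carr)
qed

lemma stalk_isomorphic: "semiring_isomorphic (stalk X F p) K"
  using csemiring.semiring_isomorphic_sym[OF csemiring_K] germ_of_value_iso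
  by (auto simp: semiring_isomorphic_def)

lemma stalk_model_transport:
  assumes iso: "presheaf_iso X F G \<phi>"
  shows "stalk_model X G K p (\<lambda>U t. ev U (inv_into (carrier (sect F U)) (\<phi> U) t))"
proof -
  note inverse = presheaf_iso_inverse[OF iso]
  let ?\<psi> = "\<lambda>U. inv_into (carrier (sect F U)) (\<phi> U)"
  have cl: "?\<psi> U t \<in> carrier (sect F U)" if "openin X U" "t \<in> carrier (sect G U)" for U t
    using semiring_homD(1)[OF semiring_isoD(1)[OF presheaf_isoD(1)[OF inverse that(1)]] that(2)] .
  have sect_inv: "\<phi> U (?\<psi> U t) = t" if "openin X U" "t \<in> carrier (sect G U)" for U t
    using that by (metis iso_inv[OF iso] iso_rep[OF iso])
  show ?thesis
  proof (rule stalk_model.intro[OF presheaf_transport[OF iso]],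
      rule stalk_model_axioms.intro[OF csemiring_K point])
    show "(\<lambda>t. ev U (?\<psi> U t)) \<in> semiring_hom (sect G U) K" if "openin X U" "p \<in> U" for U
      using that semiring_hom_comp[OF semiring_isoD(1)[OF presheaf_isoD(1)[OF inverse]] ev_hom] by blast
    show "ev V (?\<psi> V (restr G U V t)) = ev U (?\<psi> U t)"
      if "openin X U" "openin X V" "p \<in> V" "V \<subseteq> U" "t \<in> carrier (sect G U)" for U V t
      using that presheaf_isoD(2)[OF inverse] cl ev_restr by metis
    show "\<exists>U t. openin X U \<and> p \<in> U \<and> t \<in> carrier (sect G U) \<and> ev U (?\<psi> U t) = k"
      if k: "k \<in> carrier K" for k
    proof -
      obtain U s where s: "openin X U" "p \<in> U" "s \<in> carrier (sect F U)" "ev U s = k"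
        using ev_surj[OF k] by blast
      then show ?thesis
        using semiring_homD(1)[OF iso_hom[OF iso]] iso_inv[OF iso] by metis
    qed
    fix U V s t
    assume *: "openin X U" "openin X V" "p \<in> U" "p \<in> V" "s \<in> carrier (sect G U)"
      "t \<in> carrier (sect G V)" "ev U (?\<psi> U s) = ev V (?\<psi> V t)"
    then obtain W where W: "openin X W" "p \<in> W" "W \<subseteq> U \<inter> V"
        "restr F U W (?\<psi> U s) = restr F V W (?\<psi> V t)"
      using ev_separated[of U V] cl by meson
    have "restr G U W s = \<phi> W (restr F U W (?\<psi> U s))" "restr G V W t = \<phi> W (restr F V W (?\<psi> V t))"
      using presheaf_isoD(2)[OF iso] * W cl sect_inv by (metis le_inf_iff)+
    then show "\<exists>W. openin X W \<and> p \<in> W \<and> W \<subseteq> U \<inter> V \<and> restr G U W s = restr G V W t"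
      using W by auto
  qed
qed

end

section \<open>Sections that are locally fractions\<close>

context csemiring
begin

text \<open>The condition at a single point in the definition of the third sheaf.\<close>

definition fraction_near :: "'a set set \<Rightarrow> ('a set \<Rightarrow> ('a \<times> 'a) set) \<Rightarrow> 'a set \<Rightarrow> bool" where
  "fraction_near U s P \<longleftrightarrow> (\<exists>V a f. openin (zariski R) V \<and> P \<in> V \<and> V \<subseteq> U \<and>
     a \<in> carrier R \<and> f \<in> carrier R \<and> (\<forall>Q\<in>V. f \<notin> Q \<and> s Q = fraction R (carrier R - Q) a f))"

definition locally_fraction :: "'a set set \<Rightarrow> ('a set \<Rightarrow> ('a \<times> 'a) set) \<Rightarrow> bool" where
  "locally_fraction U s \<longleftrightarrow> (\<forall>P\<in>U. fraction_near U s P)"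

lemma struct_C_sect:
  "sect (struct_C R) U = subproduct U (loc_prime R)
     {s \<in> (\<Pi>\<^sub>E P\<in>U. carrier (loc_prime R P)). locally_fraction U s}"
  by (simp add: struct_C_def locally_fraction_def fraction_near_def)

lemma struct_C_carrier:
  "s \<in> carrier (sect (struct_C R) U) \<longleftrightarrow>
     s \<in> (\<Pi>\<^sub>E P\<in>U. carrier (loc_prime R P)) \<and> locally_fraction U s"
  by (simp add: struct_C_sect)

lemma struct_C_restr: "restr (struct_C R) U V s = restrict s V"
  by (simp add: struct_C_def)

lemma loc_prime_carrier:
  "carrier (loc_prime R P) = {fraction R (carrier R - P) a s | a s. a \<in> carrier R \<and> s \<in> carrier R - P}"
  by (simp add: loc_prime_def localization_simps)

lemma locally_fractionE:
  assumes "locally_fraction U s" "P \<in> U"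
  obtains V a f where "openin (zariski R) V" "P \<in> V" "V \<subseteq> U" "a \<in> carrier R" "f \<in> carrier R"
    "\<forall>Q\<in>V. f \<notin> Q \<and> s Q = fraction R (carrier R - Q) a f"
  using assms(1)[unfolded locally_fraction_def fraction_near_def, rule_format, OF assms(2)]
  by (elim exE conjE) (rule that)

lemma fraction_nearI:
  assumes "openin (zariski R) V" "P \<in> V" "V \<subseteq> U" "a \<in> carrier R" "f \<in> carrier R"
    and "\<And>Q. Q \<in> V \<Longrightarrow> f \<notin> Q \<and> s Q = fraction R (carrier R - Q) a f"
  shows "fraction_near U s P"
  using assms unfolding fraction_near_def by blast

lemma locally_fractionI:
  "(\<And>P. P \<in> U \<Longrightarrow> fraction_near U s P) \<Longrightarrow> locally_fraction U s"
  by (simp add: locally_fraction_def)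

text \<open>The values of a function that is locally a fraction lie in the local semirings automatically.\<close>

lemma struct_C_I:
  assumes "s \<in> extensional U" "locally_fraction U s"
  shows "s \<in> carrier (sect (struct_C R) U)"
proof -
  have "s P \<in> carrier (loc_prime R P)" if P: "P \<in> U" for P
  proof -
    obtain V a f where "openin (zariski R) V" "P \<in> V" "a \<in> carrier R" "f \<in> carrier R"
        "f \<notin> P" "s P = fraction R (carrier R - P) a f"
      by (rule locally_fractionE[OF assms(2) P]) blast
    then show ?thesis by (auto simp: loc_prime_carrier)
  qed
  then show ?thesis using assms by (auto simp: struct_C_carrier PiE_def)
qed

lemma locally_fraction_cong:
  assumes "locally_fraction U s" "\<And>P. P \<in> U \<Longrightarrow> t P = s P"
  shows "locally_fraction U t"
proof (rule locally_fractionI)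
  fix P assume "P \<in> U"
  then obtain V a f where V: "openin (zariski R) V" "P \<in> V" "V \<subseteq> U" "a \<in> carrier R" "f \<in> carrier R"
    "\<forall>Q\<in>V. f \<notin> Q \<and> s Q = fraction R (carrier R - Q) a f"
    by (rule locally_fractionE[OF assms(1)])
  then have "\<forall>Q\<in>V. f \<notin> Q \<and> t Q = fraction R (carrier R - Q) a f" using assms(2) by auto
  then show "fraction_near U t P" using V by (intro fraction_nearI[of V _ _ a f]) auto
qed

lemma locally_fraction_restrict:
  assumes s: "locally_fraction U s" and V: "openin (zariski R) V" "V \<subseteq> U"
  shows "locally_fraction V s"
proof (rule locally_fractionI)
  fix P assume P: "P \<in> V"
  then have "P \<in> U" using V by blast
  then obtain W a f where W: "openin (zariski R) W" "P \<in> W" "W \<subseteq> U" "a \<in> carrier R" "f \<in> carrier R"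
    "\<forall>Q\<in>W. f \<notin> Q \<and> s Q = fraction R (carrier R - Q) a f"
    by (rule locally_fractionE[OF s])
  then show "fraction_near V s P"
    using P V by (intro fraction_nearI[of "W \<inter> V" _ _ a f]) auto
qed

lemma locally_fraction_local:
  assumes "\<And>P. P \<in> U \<Longrightarrow> \<exists>V. openin (zariski R) V \<and> P \<in> V \<and> V \<subseteq> U \<and> locally_fraction V s"
  shows "locally_fraction U s"
proof (rule locally_fractionI)
  fix P assume "P \<in> U"
  then obtain V where V: "P \<in> V" "V \<subseteq> U" "locally_fraction V s" using assms by blast
  obtain W a f where "openin (zariski R) W" "P \<in> W" "W \<subseteq> V" "a \<in> carrier R" "f \<in> carrier R"
    "\<forall>Q\<in>W. f \<notin> Q \<and> s Q = fraction R (carrier R - Q) a f"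
    by (rule locally_fractionE[OF V(3,1)])
  then show "fraction_near U s P" using V(2) by (intro fraction_nearI[of W _ _ a f]) auto
qed

lemma locally_fraction_single:
  assumes "openin (zariski R) U" "a \<in> carrier R" "f \<in> denom R U"
  shows "locally_fraction U (\<lambda>P. fraction R (carrier R - P) a f)"
proof (rule locally_fractionI)
  fix P assume "P \<in> U"
  then show "fraction_near U (\<lambda>P. fraction R (carrier R - P) a f) P"
    using assms by (intro fraction_nearI[of U _ _ a f]) (auto simp: denom_def principal_open_def)
qed

text \<open>Sums and products of fractions differ only in the numerator, so one argument with an arbitrary
  numerator \<open>num\<close> covers both.\<close>

lemma locally_fraction_binary:
  assumes s: "locally_fraction U s" and t: "locally_fraction U t" and U: "U \<subseteq> Spec R"
    and op: "\<And>P a f b g. P \<in> Spec R \<Longrightarrow> a \<in> carrier R \<Longrightarrow> b \<in> carrier R \<Longrightarrow>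
      f \<in> carrier R - P \<Longrightarrow> g \<in> carrier R - P \<Longrightarrow>
      op P (fraction R (carrier R - P) a f) (fraction R (carrier R - P) b g) =
        fraction R (carrier R - P) (num a f b g) (f \<otimes> g)"
    and num: "\<And>a f b g. a \<in> carrier R \<Longrightarrow> b \<in> carrier R \<Longrightarrow> f \<in> carrier R \<Longrightarrow> g \<in> carrier R \<Longrightarrow>
      num a f b g \<in> carrier R"
  shows "locally_fraction U (\<lambda>P. op P (s P) (t P))"
proof (rule locally_fractionI)
  fix P assume P: "P \<in> U"
  obtain V a f where V: "openin (zariski R) V" "P \<in> V" "V \<subseteq> U" "a \<in> carrier R" "f \<in> carrier R"
    "\<forall>Q\<in>V. f \<notin> Q \<and> s Q = fraction R (carrier R - Q) a f"
    by (rule locally_fractionE[OF s P])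
  obtain W b g where W: "openin (zariski R) W" "P \<in> W" "W \<subseteq> U" "b \<in> carrier R" "g \<in> carrier R"
    "\<forall>Q\<in>W. g \<notin> Q \<and> t Q = fraction R (carrier R - Q) b g"
    by (rule locally_fractionE[OF t P])
  have "f \<otimes> g \<notin> Q \<and> op Q (s Q) (t Q) = fraction R (carrier R - Q) (num a f b g) (f \<otimes> g)"
    if "Q \<in> V \<inter> W" for Q
    using that V W U op[of Q a b f g] prime_mult_iff[of Q f g] by auto
  then show "fraction_near U (\<lambda>P. op P (s P) (t P)) P"
    using V W num
    by (intro fraction_nearI[of "V \<inter> W" _ _ "num a f b g" "f \<otimes> g"]) auto
qed

lemma csemiring_struct_C:
  assumes U: "openin (zariski R) U"
  shows "csemiring (sect (struct_C R) U)"
proof -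
  let ?K = "{s \<in> (\<Pi>\<^sub>E P\<in>U. carrier (loc_prime R P)). locally_fraction U s}"
  have memI: "(\<lambda>P\<in>U. h P) \<in> ?K" if "locally_fraction U h" for h
    using struct_C_I[of "\<lambda>P\<in>U. h P" U] locally_fraction_cong[OF that, of "\<lambda>P\<in>U. h P"]
    by (simp add: struct_C_carrier)
  have Spec: "U \<subseteq> Spec R" by (rule openin_subset_Spec[OF U])
  have one: "\<one> \<in> denom R U" using submonoid.one_closed[OF submonoid_denom[OF U]] .
  show ?thesis
    unfolding struct_C_sect
  proof (rule csemiring_subproduct)
    show "(\<lambda>P\<in>U. \<one>\<^bsub>loc_prime R P\<^esub>) \<in> ?K" "(\<lambda>P\<in>U. \<zero>\<^bsub>loc_prime R P\<^esub>) \<in> ?K"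
      using memI[OF locally_fraction_single[OF U _ one]]
      by (simp_all add: loc_prime_def localization_simps)
  next
    fix s t assume "s \<in> ?K" "t \<in> ?K"
    then have st: "locally_fraction U s" "locally_fraction U t" by auto
    show "(\<lambda>P\<in>U. s P \<otimes>\<^bsub>loc_prime R P\<^esub> t P) \<in> ?K"
      by (rule memI, rule locally_fraction_binary[OF st Spec, where num = "\<lambda>a f b g. a \<otimes> b"])
        (auto simp: loc_prime_def fraction_mult[OF submonoid_prime_compl])
    show "(\<lambda>P\<in>U. s P \<oplus>\<^bsub>loc_prime R P\<^esub> t P) \<in> ?K"
      by (rule memI, rule locally_fraction_binary[OF st Spec, where num = "\<lambda>a f b g. a \<otimes> g \<oplus> b \<otimes> f"])
        (auto simp: loc_prime_def fraction_add[OF submonoid_prime_compl])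
  qed (use Spec csemiring_loc_prime in auto)
qed

lemma struct_C_ev_hom: "P \<in> U \<Longrightarrow> (\<lambda>s. s P) \<in> semiring_hom (sect (struct_C R) U) (loc_prime R P)"
  unfolding struct_C_sect by (rule semiring_hom_projection) auto

lemma struct_C_eqI:
  assumes "s \<in> carrier (sect (struct_C R) U)" "t \<in> carrier (sect (struct_C R) U)"
    and "\<And>P. P \<in> U \<Longrightarrow> s P = t P"
  shows "s = t"
  using assms unfolding struct_C_carrier by (meson PiE_ext)

lemma semiring_sheaf_struct_C: "semiring_sheaf (zariski R) (struct_C R)"
proof (rule semiring_sheaf.intro[OF semiring_presheaf.intro semiring_sheaf_axioms.intro])
  show "csemiring (sect (struct_C R) U)" if "openin (zariski R) U" for U
    using that by (rule csemiring_struct_C)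
  show "restr (struct_C R) U V \<in> semiring_hom (sect (struct_C R) U) (sect (struct_C R) V)"
    if "openin (zariski R) U" "openin (zariski R) V" "V \<subseteq> U" for U V
  proof -
    have "(\<lambda>s. \<lambda>P\<in>V. s P) \<in> semiring_hom (sect (struct_C R) U) (sect (struct_C R) V)"
      unfolding struct_C_sect[of V]
    proof (rule semiring_hom_into_subproduct)
      show "(\<lambda>s. s P) \<in> semiring_hom (sect (struct_C R) U) (loc_prime R P)" if "P \<in> V" for P
        using that \<open>V \<subseteq> U\<close> by (intro struct_C_ev_hom) blast
      show "(\<lambda>P\<in>V. s P) \<in> {s \<in> \<Pi>\<^sub>E P\<in>V. carrier (loc_prime R P). locally_fraction V s}"
        if "s \<in> carrier (sect (struct_C R) U)" for s
      proof -
        have "locally_fraction V s"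
          using locally_fraction_restrict that \<open>openin (zariski R) V\<close> \<open>V \<subseteq> U\<close>
          by (auto simp: struct_C_carrier)
        then have "restrict s V \<in> carrier (sect (struct_C R) V)"
          by (intro struct_C_I) (auto intro: locally_fraction_cong)
        then show ?thesis by (simp add: struct_C_carrier)
      qed
    qed
    moreover have "restr (struct_C R) U V = (\<lambda>s. \<lambda>P\<in>V. s P)"
      by (simp add: struct_C_def restrict_def)
    ultimately show ?thesis by simp
  qed
  show "restr (struct_C R) U U s = s"
    if "openin (zariski R) U" "s \<in> carrier (sect (struct_C R) U)" for U s
    using that by (metis PiE_restrict struct_C_carrier struct_C_restr)
  show "restr (struct_C R) V W (restr (struct_C R) U V s) = restr (struct_C R) U W s"
    if "W \<subseteq> V" for U V W s
    using that by (simp add: struct_C_restr Int_absorb1)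
next
  fix \<U> s t
  assume st: "s \<in> carrier (sect (struct_C R) (\<Union>\<U>))" "t \<in> carrier (sect (struct_C R) (\<Union>\<U>))"
    and eq: "\<And>V. V \<in> \<U> \<Longrightarrow> restr (struct_C R) (\<Union>\<U>) V s = restr (struct_C R) (\<Union>\<U>) V t"
  have "s P = t P" if "P \<in> \<Union>\<U>" for P
    using that eq by (metis UnionE restrict_apply' struct_C_restr)
  then show "s = t" by (rule struct_C_eqI[OF st])
next
  fix \<U> \<sigma>
  assume o: "\<And>V. V \<in> \<U> \<Longrightarrow> openin (zariski R) V"
    and \<sigma>: "\<And>V. V \<in> \<U> \<Longrightarrow> \<sigma> V \<in> carrier (sect (struct_C R) V)"
    and eq: "\<And>V W. V \<in> \<U> \<Longrightarrow> W \<in> \<U> \<Longrightarrow>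
      restr (struct_C R) V (V \<inter> W) (\<sigma> V) = restr (struct_C R) W (V \<inter> W) (\<sigma> W)"
  \<comment> \<open>any member of the cover containing \<open>P\<close> serves, by compatibility on overlaps\<close>
  define nbhd where "nbhd P = (SOME V. V \<in> \<U> \<and> P \<in> V)" for P
  have nbhd: "nbhd P \<in> \<U>" "P \<in> nbhd P" if "P \<in> \<Union>\<U>" for P
    using that someI_ex[of "\<lambda>V. V \<in> \<U> \<and> P \<in> V"] by (auto simp: nbhd_def)
  define s where "s = (\<lambda>P\<in>\<Union>\<U>. \<sigma> (nbhd P) P)"
  have s: "s P = \<sigma> V P" if "V \<in> \<U>" "P \<in> V" for V P
  proof -
    have P: "P \<in> \<Union>\<U>" using that by blast
    have "restrict (\<sigma> (nbhd P)) (nbhd P \<inter> V) P = restrict (\<sigma> V) (nbhd P \<inter> V) P"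
      using eq[OF nbhd(1)[OF P] that(1)] by (simp add: struct_C_restr)
    then show ?thesis using nbhd[OF P] that P by (simp add: s_def)
  qed
  have "locally_fraction (\<Union>\<U>) s"
  proof (rule locally_fraction_local)
    fix P assume "P \<in> \<Union>\<U>"
    then obtain V where V: "V \<in> \<U>" "P \<in> V" by blast
    have "locally_fraction V s"
      using \<sigma>[OF V(1)] s[OF V(1)] locally_fraction_cong[of V "\<sigma> V" s] by (simp add: struct_C_carrier)
    then show "\<exists>V. openin (zariski R) V \<and> P \<in> V \<and> V \<subseteq> \<Union>\<U> \<and> locally_fraction V s"
      using V o by blast
  qed
  then have "s \<in> carrier (sect (struct_C R) (\<Union>\<U>))"
    by (intro struct_C_I) (auto simp: s_def)
  moreover have "restr (struct_C R) (\<Union>\<U>) V s = \<sigma> V" if V: "V \<in> \<U>" for V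
    using \<sigma>[OF V] s[OF V] unfolding struct_C_restr struct_C_carrier
    by (intro PiE_ext[of "restrict s V" V "\<lambda>P. carrier (loc_prime R P)" "\<sigma> V"]) auto
  ultimately show "\<exists>s\<in>carrier (sect (struct_C R) (\<Union>\<U>)). \<forall>V\<in>\<U>. restr (struct_C R) (\<Union>\<U>) V s = \<sigma> V"
    by blast
qed

section \<open>Stalks\<close>

text \<open>Every \<open>a/f\<close> in \<open>A\<^sub>P\<close> is the value of a fraction on the neighbourhood \<open>D(f)\<close>, and an equation
  \<open>a g u = b f u\<close> with \<open>u \<notin> P\<close>, which witnesses \<open>a/f = b/g\<close> at \<open>P\<close>, witnesses it on all of \<open>D(u)\<close>.\<close>

lemma stalk_model_pre_struct:
  assumes P: "P \<in> Spec R"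
  shows "stalk_model (zariski R) (pre_struct R) (loc_prime R P) P (\<lambda>U. loc_map R (carrier R - P))"
proof (rule stalk_model.intro[OF semiring_presheaf_pre_struct], rule stalk_model_axioms.intro)
  show "csemiring (loc_prime R P)" by (rule csemiring_loc_prime[OF P])
  show "P \<in> topspace (zariski R)" using P by (simp add: topspace_zariski)
  show "loc_map R (carrier R - P) \<in> semiring_hom (sect (pre_struct R) U) (loc_prime R P)"
    if "openin (zariski R) U" "P \<in> U" for U
    using that by (rule loc_map_prime_hom)
  show "loc_map R (carrier R - P) (restr (pre_struct R) U V s) = loc_map R (carrier R - P) s"
    if "openin (zariski R) U" "openin (zariski R) V" "P \<in> V" "V \<subseteq> U" "s \<in> carrier (sect (pre_struct R) U)"
    for U V s
    using that denom_mono[of V U] by (auto simp: pre_struct_carrier pre_struct_restr loc_map_prime subset_iff)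
  show "\<exists>U s. openin (zariski R) U \<and> P \<in> U \<and> s \<in> carrier (sect (pre_struct R) U) \<and>
      loc_map R (carrier R - P) s = k" if k: "k \<in> carrier (loc_prime R P)" for k
  proof -
    obtain a f where af: "k = fraction R (carrier R - P) a f" "a \<in> carrier R" "f \<in> carrier R" "f \<notin> P"
      using k by (auto simp: loc_prime_carrier)
    let ?U = "principal_open R f"
    have "openin (zariski R) ?U" "P \<in> ?U" "f \<in> denom R ?U"
      using af P openin_principal_open by (auto simp: principal_open_def denom_def)
    moreover from this have "loc_map R (carrier R - P) (fraction R (denom R ?U) a f) = k"
      using loc_map_prime af by simp
    ultimately show ?thesis using af unfolding pre_struct_carrier by blast
  qed
  fix U V s t
  assume o: "openin (zariski R) U" "openin (zariski R) V" "P \<in> U" "P \<in> V"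
    and st: "s \<in> carrier (sect (pre_struct R) U)" "t \<in> carrier (sect (pre_struct R) V)"
    and eq: "loc_map R (carrier R - P) s = loc_map R (carrier R - P) t"
  obtain a f where s: "s = fraction R (denom R U) a f" "a \<in> carrier R" "f \<in> denom R U"
    using st by (auto simp: pre_struct_carrier)
  obtain b g where t: "t = fraction R (denom R V) b g" "b \<in> carrier R" "g \<in> denom R V"
    using st by (auto simp: pre_struct_carrier)
  have fg: "f \<in> carrier R - P" "g \<in> carrier R - P"
    using s t o denom_subset_prime_compl by auto
  have "fraction R (carrier R - P) a f = fraction R (carrier R - P) b g"
    using eq s t o by (simp add: loc_map_prime)
  then obtain u where u: "u \<in> carrier R - P" "a \<otimes> g \<otimes> u = b \<otimes> f \<otimes> u"
    using fraction_eq_iff[OF submonoid_prime_compl[OF P] s(2) t(2) fg] by blast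
  let ?W = "U \<inter> V \<inter> principal_open R u"
  have W: "openin (zariski R) ?W" "P \<in> ?W" "?W \<subseteq> U \<inter> V"
    using o u P openin_principal_open by (auto simp: principal_open_def)
  have d: "f \<in> denom R ?W" "g \<in> denom R ?W" "u \<in> denom R ?W"
    using s t u by (auto simp: denom_def)
  have "restr (pre_struct R) U ?W s = restr (pre_struct R) V ?W t"
    using o W s t d u fraction_eq_iff[OF submonoid_denom[OF W(1)] s(2) t(2) d(1,2)]
    by (auto simp: pre_struct_restr)
  then show "\<exists>W. openin (zariski R) W \<and> P \<in> W \<and> W \<subseteq> U \<inter> V \<and>
      restr (pre_struct R) U W s = restr (pre_struct R) V W t"
    using W by blast
qed

lemma to_struct_C_hom:
  assumes U: "openin (zariski R) U"
  shows "to_struct_C R U \<in> semiring_hom (sect (pre_struct R) U) (sect (struct_C R) U)"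
  unfolding to_struct_C_def[abs_def] struct_C_sect
proof (rule semiring_hom_into_subproduct)
  fix x assume "x \<in> carrier (sect (pre_struct R) U)"
  then obtain a f where x: "x = fraction R (denom R U) a f" "a \<in> carrier R" "f \<in> denom R U"
    by (auto simp: pre_struct_carrier)
  have "locally_fraction U (\<lambda>P\<in>U. loc_map R (carrier R - P) x)"
    by (rule locally_fraction_cong[OF locally_fraction_single[OF U x(2,3)]])
      (use loc_map_prime[OF U _ x(2,3)] x(1) in simp)
  then show "(\<lambda>P\<in>U. loc_map R (carrier R - P) x)
      \<in> {s \<in> \<Pi>\<^sub>E P\<in>U. carrier (loc_prime R P). locally_fraction U s}"
    using struct_C_I[of "\<lambda>P\<in>U. loc_map R (carrier R - P) x" U] by (simp add: struct_C_carrier)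
qed (use loc_map_prime_hom[OF U] in blast)

lemma to_struct_C_fraction:
  assumes "openin (zariski R) U" "P \<in> U" "a \<in> carrier R" "f \<in> denom R U"
  shows "to_struct_C R U (fraction R (denom R U) a f) P = fraction R (carrier R - P) a f"
  using assms by (simp add: to_struct_C_def loc_map_prime)

lemma to_struct_C_restr:
  assumes "openin (zariski R) U" "openin (zariski R) V" "V \<subseteq> U" "x \<in> carrier (sect (pre_struct R) U)"
  shows "to_struct_C R V (restr (pre_struct R) U V x) = restrict (to_struct_C R U x) V"
proof -
  obtain a f where x: "x = fraction R (denom R U) a f" "a \<in> carrier R" "f \<in> denom R U"
    using assms(4) by (auto simp: pre_struct_carrier)
  have "f \<in> denom R V" using x(3) denom_mono[OF assms(3)] by blast
  then have "loc_map R (carrier R - P) (restr (pre_struct R) U V x) = loc_map R (carrier R - P) x"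
    if "P \<in> V" for P
    using assms x that by (simp add: pre_struct_restr loc_map_prime subset_iff)
  then show ?thesis
    using assms(3) by (auto simp: to_struct_C_def Int_absorb1 intro!: restrict_ext)
qed

text \<open>Surjectivity is inherited from the presheaf of fractions; separation is again the equation
  \<open>a g u = b f u\<close>, which forces equal values at every point of \<open>D(u)\<close>.\<close>

lemma stalk_model_struct_C:
  assumes P: "P \<in> Spec R"
  shows "stalk_model (zariski R) (struct_C R) (loc_prime R P) P (\<lambda>U s. s P)"
proof (rule stalk_model.intro[OF semiring_sheaf.axioms(1)[OF semiring_sheaf_struct_C]],
    rule stalk_model_axioms.intro)
  show "csemiring (loc_prime R P)" by (rule csemiring_loc_prime[OF P])
  show "P \<in> topspace (zariski R)" using P by (simp add: topspace_zariski)
  show "(\<lambda>s. s P) \<in> semiring_hom (sect (struct_C R) U) (loc_prime R P)" if "P \<in> U" for U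
    by (rule struct_C_ev_hom[OF that])
  show "restr (struct_C R) U V s P = s P" if "P \<in> V" for U V s
    using that by (simp add: struct_C_restr)
  show "\<exists>U s. openin (zariski R) U \<and> P \<in> U \<and> s \<in> carrier (sect (struct_C R) U) \<and> s P = k"
    if k: "k \<in> carrier (loc_prime R P)" for k
  proof -
    interpret F: stalk_model "zariski R" "pre_struct R" "loc_prime R P" P "\<lambda>U. loc_map R (carrier R - P)"
      by (rule stalk_model_pre_struct[OF P])
    obtain U x where x: "openin (zariski R) U" "P \<in> U" "x \<in> carrier (sect (pre_struct R) U)"
        "loc_map R (carrier R - P) x = k" using F.ev_surj[OF k] by blast
    have "to_struct_C R U x \<in> carrier (sect (struct_C R) U)"
      using semiring_homD(1)[OF to_struct_C_hom] x by blast
    moreover have "to_struct_C R U x P = k" using x by (simp add: to_struct_C_def)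
    ultimately show ?thesis using x by blast
  qed
  fix U V s t
  assume o: "openin (zariski R) U" "openin (zariski R) V" "P \<in> U" "P \<in> V"
    and st: "s \<in> carrier (sect (struct_C R) U)" "t \<in> carrier (sect (struct_C R) V)"
    and eq: "s P = t P"
  obtain V1 a f where s: "openin (zariski R) V1" "P \<in> V1" "V1 \<subseteq> U" "a \<in> carrier R" "f \<in> carrier R"
    "\<forall>Q\<in>V1. f \<notin> Q \<and> s Q = fraction R (carrier R - Q) a f"
    by (rule locally_fractionE[of U s P]) (use st o in \<open>auto simp: struct_C_carrier\<close>)
  obtain V2 b g where t: "openin (zariski R) V2" "P \<in> V2" "V2 \<subseteq> V" "b \<in> carrier R" "g \<in> carrier R"
    "\<forall>Q\<in>V2. g \<notin> Q \<and> t Q = fraction R (carrier R - Q) b g"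
    by (rule locally_fractionE[of V t P]) (use st o in \<open>auto simp: struct_C_carrier\<close>)
  have fg: "f \<in> carrier R - P" "g \<in> carrier R - P" using s t by auto
  have "fraction R (carrier R - P) a f = fraction R (carrier R - P) b g" using eq s t by auto
  then obtain u where u: "u \<in> carrier R - P" "a \<otimes> g \<otimes> u = b \<otimes> f \<otimes> u"
    using fraction_eq_iff[OF submonoid_prime_compl[OF P] s(4) t(4) fg] by blast
  let ?W = "V1 \<inter> V2 \<inter> principal_open R u"
  have W: "openin (zariski R) ?W" "P \<in> ?W" "?W \<subseteq> U \<inter> V"
    using o s t u P openin_principal_open by (auto simp: principal_open_def)
  have "s Q = t Q" if Q: "Q \<in> ?W" for Q
  proof -
    have "Q \<in> Spec R" using Q by (auto simp: principal_open_def)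
    moreover have "f \<in> carrier R - Q" "g \<in> carrier R - Q" "u \<in> carrier R - Q"
      using Q s t u by (auto simp: principal_open_def)
    ultimately have "fraction R (carrier R - Q) a f = fraction R (carrier R - Q) b g"
      using fraction_eq_iff[OF submonoid_prime_compl s(4) t(4)] u(2) by blast
    then show ?thesis using Q s t by auto
  qed
  then have "restrict s ?W = restrict t ?W" by (intro restrict_ext)
  then show "\<exists>W. openin (zariski R) W \<and> P \<in> W \<and> W \<subseteq> U \<inter> V \<and>
      restr (struct_C R) U W s = restr (struct_C R) V W t"
    unfolding struct_C_restr using W by blast
qed


section \<open>Sections over principal open sets are fractions\<close>

text \<open>The elements \<open>u\<close> with \<open>a t u = b s u\<close> form an ideal, and equality of \<open>a/s\<close> and \<open>b/t\<close> at \<open>P\<close> says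
  that this ideal is not contained in \<open>P\<close>.\<close>

lemma fractions_eq_on_principal_open:
  assumes c: "a \<in> carrier R" "b \<in> carrier R" "s \<in> carrier R" "t \<in> carrier R" "h \<in> carrier R"
    and st: "\<And>P. P \<in> principal_open R h \<Longrightarrow> s \<notin> P \<and> t \<notin> P"
    and eq: "\<And>P. P \<in> principal_open R h \<Longrightarrow>
      fraction R (carrier R - P) a s = fraction R (carrier R - P) b t"
  shows "\<exists>n::nat. a \<otimes> t \<otimes> h [^] n = b \<otimes> s \<otimes> h [^] n"
proof -
  let ?J = "{u \<in> carrier R. a \<otimes> t \<otimes> u = b \<otimes> s \<otimes> u}"
  have "semiring_ideal R ?J"
    unfolding semiring_ideal_def
  proof (intro conjI ballI)
    fix x y assume "x \<in> carrier R" "y \<in> ?J"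
    then have y: "y \<in> carrier R" "a \<otimes> t \<otimes> y = b \<otimes> s \<otimes> y" "x \<in> carrier R" by auto
    have "a \<otimes> t \<otimes> (x \<otimes> y) = x \<otimes> (a \<otimes> t \<otimes> y)" using c y by (simp add: m_ac)
    also have "\<dots> = b \<otimes> s \<otimes> (x \<otimes> y)" unfolding y(2) using c y by (simp add: m_ac)
    finally show "x \<otimes> y \<in> ?J" using y by simp
  qed (use c in \<open>auto simp: r_distr\<close>)
  moreover have "\<exists>u\<in>?J. u \<notin> P" if P: "P \<in> principal_open R h" for P
  proof -
    have "P \<in> Spec R" using P by (simp add: principal_open_def)
    then show ?thesis
      using fraction_eq_iff[OF submonoid_prime_compl c(1,2)] eq[OF P] st[OF P] c by auto
  qed
  ultimately show ?thesis using power_in_ideal[OF _ c(5), of ?J] by blast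
qed

text \<open>Linear combinations can be avoided: the \<open>x\<close> for which finitely many members of \<open>E\<close> suffice to
  cover \<open>D(x)\<close> form an ideal, because \<open>D(x + y) \<subseteq> D(x) \<union> D(y)\<close>. It contains \<open>E\<close>, hence a power of
  \<open>a\<close>.\<close>

lemma principal_open_compact:
  assumes a: "a \<in> carrier R" and E: "E \<subseteq> carrier R"
    and cover: "\<And>P. P \<in> principal_open R a \<Longrightarrow> \<exists>e\<in>E. e \<notin> P"
  shows "\<exists>F\<subseteq>E. finite F \<and> (\<forall>P\<in>principal_open R a. \<exists>e\<in>F. e \<notin> P)"
proof -
  let ?J = "{x \<in> carrier R. \<exists>F\<subseteq>E. finite F \<and> (\<forall>P\<in>principal_open R x. \<exists>e\<in>F. e \<notin> P)}"
  have "semiring_ideal R ?J"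
    unfolding semiring_ideal_def
  proof (intro conjI ballI)
    have "principal_open R \<zero> = {}"
      using semiring_idealD(2)[OF prime_ideal] by (auto simp: principal_open_def)
    then show "\<zero> \<in> ?J" by auto
  next
    fix x y assume xy: "x \<in> ?J" "y \<in> ?J"
    then obtain F G where F: "F \<subseteq> E" "finite F" "\<forall>P\<in>principal_open R x. \<exists>e\<in>F. e \<notin> P"
      and G: "G \<subseteq> E" "finite G" "\<forall>P\<in>principal_open R y. \<exists>e\<in>G. e \<notin> P" by auto
    have "\<exists>e\<in>F \<union> G. e \<notin> P" if "P \<in> principal_open R (x \<oplus> y)" for P
    proof -
      have "P \<in> Spec R" "x \<oplus> y \<notin> P" using that by (auto simp: principal_open_def)
      then have "x \<notin> P \<or> y \<notin> P" using semiring_idealD(3)[OF prime_ideal] by blast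
      then show ?thesis using F(3) G(3) \<open>P \<in> Spec R\<close> by (auto simp: principal_open_def)
    qed
    then show "x \<oplus> y \<in> ?J" using xy F G by (auto intro!: exI[of _ "F \<union> G"])
  next
    fix x y assume x: "x \<in> carrier R" and y: "y \<in> ?J"
    then obtain F where F: "F \<subseteq> E" "finite F" "\<forall>P\<in>principal_open R y. \<exists>e\<in>F. e \<notin> P" by auto
    moreover have "principal_open R (x \<otimes> y) \<subseteq> principal_open R y"
      using x y principal_open_mult by auto
    ultimately have "\<forall>P\<in>principal_open R (x \<otimes> y). \<exists>e\<in>F. e \<notin> P" by blast
    then show "x \<otimes> y \<in> ?J" using x y F by auto
  qed auto
  moreover have "\<exists>e\<in>?J. e \<notin> P" if P: "P \<in> principal_open R a" for P
  proof -
    obtain e where "e \<in> E" "e \<notin> P" using cover[OF P] by blast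
    moreover from this have "e \<in> ?J"
      using E by (auto simp: principal_open_def intro!: exI[of _ "{e}"])
    ultimately show ?thesis by blast
  qed
  ultimately obtain n :: nat where "a [^] n \<in> ?J" using power_in_ideal[OF _ a, of ?J] by blast
  then obtain F where F: "F \<subseteq> E" "finite F" "\<forall>P\<in>principal_open R (a [^] n). \<exists>e\<in>F. e \<notin> P" by auto
  have "principal_open R a \<subseteq> principal_open R (a [^] n)"
    using a by (auto simp: principal_open_def prime_power_iff)
  then show ?thesis using F by blast
qed

lemma to_struct_C_inj:
  assumes h: "h \<in> carrier R"
  shows "inj_on (to_struct_C R (principal_open R h)) (carrier (sect (pre_struct R) (principal_open R h)))"
proof (rule inj_onI)
  let ?U = "principal_open R h"
  note U = openin_principal_open[OF h]
  fix x y assume "x \<in> carrier (sect (pre_struct R) ?U)" "y \<in> carrier (sect (pre_struct R) ?U)"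
    and eq: "to_struct_C R ?U x = to_struct_C R ?U y"
  then obtain a s b t where x: "x = fraction R (denom R ?U) a s" "a \<in> carrier R" "s \<in> denom R ?U"
    and y: "y = fraction R (denom R ?U) b t" "b \<in> carrier R" "t \<in> denom R ?U"
    unfolding pre_struct_carrier by blast
  have st: "s \<in> carrier R" "t \<in> carrier R" using x y by (auto simp: denom_def)
  have "\<exists>n::nat. a \<otimes> t \<otimes> h [^] n = b \<otimes> s \<otimes> h [^] n"
  proof (rule fractions_eq_on_principal_open[OF x(2) y(2) st h])
    show "s \<notin> P \<and> t \<notin> P" if "P \<in> ?U" for P
      using that x y denom_subset_prime_compl by blast
    show "fraction R (carrier R - P) a s = fraction R (carrier R - P) b t" if "P \<in> ?U" for P
      using fun_cong[OF eq, of P] that x y U by (simp add: to_struct_C_fraction)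
  qed
  moreover have "h [^] n \<in> denom R ?U" for n :: nat
    using h by (auto simp: denom_def principal_open_def prime_power_iff)
  ultimately show "x = y"
    using fraction_eq_iff[OF submonoid_denom[OF U] x(2) y(2) x(3) y(3)] x(1) y(1) by blast
qed

text \<open>The gluing of local fractions into one. Instead of writing a power of \<open>h\<close> as a linear
  combination of the denominators and taking the same combination of the numerators, the proof
  considers the ideal of all \<open>x\<close> that are a denominator compatible with the finitely many given
  fractions.\<close>

lemma to_struct_C_surj:
  assumes h: "h \<in> carrier R" and s: "s \<in> carrier (sect (struct_C R) (principal_open R h))"
  shows "s \<in> to_struct_C R (principal_open R h) ` carrier (sect (pre_struct R) (principal_open R h))"
proof -
  let ?U = "principal_open R h"
  note U = openin_principal_open[OF h]
  define rep where "rep e b \<longleftrightarrow> e \<in> carrier R \<and> b \<in> carrier R \<and> principal_open R e \<subseteq> ?U \<and>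
    (\<forall>Q\<in>principal_open R e. s Q = fraction R (carrier R - Q) b e)" for e b
  have loc: "locally_fraction ?U s" using s by (simp add: struct_C_carrier)
  have "\<exists>e\<in>{e. \<exists>b. rep e b}. e \<notin> P" if P: "P \<in> ?U" for P
  proof -
    obtain V b f where V: "openin (zariski R) V" "P \<in> V" "V \<subseteq> ?U" "b \<in> carrier R" "f \<in> carrier R"
      "\<forall>Q\<in>V. f \<notin> Q \<and> s Q = fraction R (carrier R - Q) b f"
      by (rule locally_fractionE[OF loc P])
    \<comment> \<open>shrink \<open>V\<close> to \<open>D(fg)\<close>, so that the neighbourhood is cut out by the denominator itself\<close>
    obtain g where g: "g \<in> carrier R" "P \<in> principal_open R g" "principal_open R g \<subseteq> V"
      using principal_open_basis[OF V(1,2)] by blast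
    have D: "principal_open R (f \<otimes> g) = principal_open R f \<inter> principal_open R g"
      by (rule principal_open_mult[OF V(5) g(1)])
    have "s Q = fraction R (carrier R - Q) (b \<otimes> g) (f \<otimes> g)" if Q: "Q \<in> principal_open R (f \<otimes> g)" for Q
    proof -
      have QS: "Q \<in> Spec R" "f \<in> carrier R - Q" "f \<otimes> g \<in> carrier R - Q" "Q \<in> V"
        using Q D V g by (auto simp: principal_open_def)
      have "b \<otimes> (f \<otimes> g) \<otimes> \<one> = (b \<otimes> g) \<otimes> f \<otimes> \<one>" using V g by (simp add: m_ac)
      then have "fraction R (carrier R - Q) b f = fraction R (carrier R - Q) (b \<otimes> g) (f \<otimes> g)"
        using fraction_eq_iff[OF submonoid_prime_compl[OF QS(1)] V(4) closed_ops(2)[OF V(4) g(1)] QS(2,3)]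
          submonoid.one_closed[OF submonoid_prime_compl[OF QS(1)]] by blast
      then show ?thesis using V(6) QS by simp
    qed
    then have "rep (f \<otimes> g) (b \<otimes> g)" using V g D by (auto simp: rep_def)
    moreover have "P \<in> principal_open R (f \<otimes> g)"
      unfolding D using V g by (auto simp: principal_open_def)
    ultimately show ?thesis by (auto simp: principal_open_def)
  qed
  moreover have "{e. \<exists>b. rep e b} \<subseteq> carrier R" by (auto simp: rep_def)
  ultimately obtain F where F: "F \<subseteq> {e. \<exists>b. rep e b}" "finite F" "\<forall>P\<in>?U. \<exists>e\<in>F. e \<notin> P"
    using principal_open_compact[OF h, of "{e. \<exists>b. rep e b}"] by metis
  have "\<forall>e\<in>F. \<exists>b. rep e b" using F(1) by blast
  then obtain \<beta> where \<beta>: "\<And>e. e \<in> F \<Longrightarrow> rep e (\<beta> e)" by metis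
  have Fc: "e \<in> carrier R" "\<beta> e \<in> carrier R" if "e \<in> F" for e using \<beta>[OF that] by (auto simp: rep_def)
  have "\<exists>n::nat. \<beta> d \<otimes> e \<otimes> (d \<otimes> e) [^] n = \<beta> e \<otimes> d \<otimes> (d \<otimes> e) [^] n" if de: "d \<in> F" "e \<in> F" for d e
  proof (rule fractions_eq_on_principal_open)
    have D: "principal_open R (d \<otimes> e) = principal_open R d \<inter> principal_open R e"
      using de Fc by (simp add: principal_open_mult)
    show "fraction R (carrier R - P) (\<beta> d) d = fraction R (carrier R - P) (\<beta> e) e"
      if "P \<in> principal_open R (d \<otimes> e)" for P
      using that D \<beta>[OF de(1)] \<beta>[OF de(2)] by (auto simp: rep_def)
    show "d \<notin> P \<and> e \<notin> P" if "P \<in> principal_open R (d \<otimes> e)" for P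
      using that D by (auto simp: principal_open_def)
  qed (use de Fc in auto)
  then obtain n :: "'a \<Rightarrow> 'a \<Rightarrow> nat" where
    n: "\<And>d e. d \<in> F \<Longrightarrow> e \<in> F \<Longrightarrow> \<beta> d \<otimes> e \<otimes> (d \<otimes> e) [^] n d e = \<beta> e \<otimes> d \<otimes> (d \<otimes> e) [^] n d e"
    by metis
  \<comment> \<open>one exponent for all pairs; a larger exponent is harmless, so the sum will do\<close>
  define N where "N = (\<Sum>d\<in>F. \<Sum>e\<in>F. n d e)"
  have N: "\<beta> d \<otimes> e \<otimes> (d \<otimes> e) [^] N = \<beta> e \<otimes> d \<otimes> (d \<otimes> e) [^] N" if de: "d \<in> F" "e \<in> F" for d e
  proof -
    have "n d e \<le> (\<Sum>e\<in>F. n d e)" using member_le_sum[OF de(2), of "n d"] F(2) by simp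
    also have "\<dots> \<le> N" unfolding N_def using member_le_sum[OF de(1), of "\<lambda>d. \<Sum>e\<in>F. n d e"] F(2) by simp
    finally obtain k where k: "N = n d e + k" using le_Suc_ex by blast
    have c: "\<beta> d \<in> carrier R" "\<beta> e \<in> carrier R" "d \<in> carrier R" "e \<in> carrier R" using Fc de by auto
    then show ?thesis
      using n[OF de] by (simp add: k nat_pow_mult[symmetric] m_assoc[symmetric])
  qed
  \<comment> \<open>rewriting \<open>\<beta> e / e\<close> with denominator \<open>e\<^sup>N\<^sup>+\<^sup>1\<close> absorbs the factor \<open>(d e)\<^sup>N\<close>\<close>
  define den where "den e = e [^] Suc N" for e
  define num where "num e = \<beta> e \<otimes> e [^] N" for e
  have dn: "den e \<in> carrier R" "num e \<in> carrier R" if "e \<in> F" for e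
    using Fc[OF that] by (simp_all add: den_def num_def)
  have cross: "num d \<otimes> den e = den d \<otimes> num e" if de: "d \<in> F" "e \<in> F" for d e
  proof -
    have c: "\<beta> d \<in> carrier R" "\<beta> e \<in> carrier R" "d \<in> carrier R" "e \<in> carrier R" using Fc de by auto
    have "num d \<otimes> den e = \<beta> d \<otimes> e \<otimes> (d \<otimes> e) [^] N"
      using c by (simp add: num_def den_def nat_pow_distrib m_ac)
    also have "\<dots> = den d \<otimes> num e"
      unfolding N[OF de] using c by (simp add: num_def den_def nat_pow_distrib m_ac)
    finally show ?thesis .
  qed
  let ?J = "{x \<in> carrier R. \<exists>y\<in>carrier R. \<forall>e\<in>F. y \<otimes> den e = x \<otimes> num e}"
  have "semiring_ideal R ?J"
    unfolding semiring_ideal_def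
  proof (intro conjI ballI)
    have "\<forall>e\<in>F. \<zero> \<otimes> den e = \<zero> \<otimes> num e" using dn by simp
    then show "\<zero> \<in> ?J" using closed_ops(3) by blast
  next
    fix x x' assume "x \<in> ?J" "x' \<in> ?J"
    then obtain y y' where x: "x \<in> carrier R" "y \<in> carrier R" "\<forall>e\<in>F. y \<otimes> den e = x \<otimes> num e"
      and x': "x' \<in> carrier R" "y' \<in> carrier R" "\<forall>e\<in>F. y' \<otimes> den e = x' \<otimes> num e" by auto
    have "\<forall>e\<in>F. (y \<oplus> y') \<otimes> den e = (x \<oplus> x') \<otimes> num e"
      using x x' dn by (simp add: l_distr)
    then show "x \<oplus> x' \<in> ?J" using x x' closed_ops(1) by blast
  next
    fix r x assume r: "r \<in> carrier R" and "x \<in> ?J"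
    then obtain y where x: "x \<in> carrier R" "y \<in> carrier R" "\<forall>e\<in>F. y \<otimes> den e = x \<otimes> num e" by auto
    have "\<forall>e\<in>F. (r \<otimes> y) \<otimes> den e = (r \<otimes> x) \<otimes> num e"
      using r x dn by (simp add: m_assoc)
    then show "r \<otimes> x \<in> ?J" using r x closed_ops(2) by blast
  qed auto
  moreover have "\<exists>x\<in>?J. x \<notin> P" if P: "P \<in> ?U" for P
  proof -
    obtain d where d: "d \<in> F" "d \<notin> P" using F(3) P by blast
    have "den d \<in> ?J" using dn cross d(1) by blast
    moreover have "den d \<notin> P"
      unfolding den_def using P d Fc by (subst prime_power_iff) (auto simp: principal_open_def)
    ultimately show ?thesis by blast
  qed
  ultimately obtain m :: nat where "h [^] m \<in> ?J" using power_in_ideal[OF _ h, of ?J] by blast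
  then obtain y where y: "y \<in> carrier R" "\<forall>e\<in>F. y \<otimes> den e = h [^] m \<otimes> num e" by blast
  let ?x = "fraction R (denom R ?U) y (h [^] m)"
  have hm: "h [^] m \<in> denom R ?U"
    using h by (auto simp: denom_def principal_open_def prime_power_iff)
  have x: "?x \<in> carrier (sect (pre_struct R) ?U)" using y hm by (auto simp: pre_struct_carrier)
  have "s = to_struct_C R ?U ?x"
  proof (rule struct_C_eqI[OF s semiring_homD(1)[OF to_struct_C_hom[OF U] x]])
    fix Q assume Q: "Q \<in> ?U"
    then obtain e where e: "e \<in> F" "e \<notin> Q" using F(3) by blast
    have QS: "Q \<in> Spec R" using Q by (simp add: principal_open_def)
    have c: "\<beta> e \<in> carrier R" "e \<in> carrier R" using Fc e by auto
    have "s Q = fraction R (carrier R - Q) (\<beta> e) e"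
      using \<beta>[OF e(1)] e QS by (auto simp: rep_def principal_open_def)
    also have "\<dots> = fraction R (carrier R - Q) y (h [^] m)"
    proof -
      have "\<beta> e \<otimes> h [^] m \<otimes> e [^] N = h [^] m \<otimes> num e" using c h by (simp add: num_def m_ac)
      also have "\<dots> = y \<otimes> e \<otimes> e [^] N"
        using y(2)[rule_format, OF e(1), symmetric] c y(1) by (simp add: den_def m_ac)
      finally have "\<beta> e \<otimes> h [^] m \<otimes> e [^] N = y \<otimes> e \<otimes> e [^] N" .
      moreover have "e [^] N \<in> carrier R - Q" using c e by (simp add: prime_power_iff[OF QS])
      moreover have "h [^] m \<in> carrier R - Q" using hm Q denom_subset_prime_compl by blast
      ultimately show ?thesis
        using fraction_eq_iff[OF submonoid_prime_compl[OF QS] c(1) y(1)] c e by blast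
    qed
    also have "\<dots> = to_struct_C R ?U ?x Q" using to_struct_C_fraction[OF U Q y(1) hm] by simp
    finally show "s Q = to_struct_C R ?U ?x Q" .
  qed
  then show ?thesis using x by blast
qed

lemma to_struct_C_iso:
  "h \<in> carrier R \<Longrightarrow> to_struct_C R (principal_open R h)
    \<in> semiring_iso (sect (pre_struct R) (principal_open R h)) (sect (struct_C R) (principal_open R h))"
  using to_struct_C_hom[OF openin_principal_open] to_struct_C_inj to_struct_C_surj
  by (intro semiring_isoI) auto

section \<open>The extension from the basis of principal open sets\<close>

text \<open>For a section \<open>s\<close> over an open set containing \<open>D(h)\<close>, the unique fraction over \<open>D(h)\<close>
  with the values of \<open>s\<close> there.\<close>

definition representing_fraction :: "'a \<Rightarrow> ('a set \<Rightarrow> ('a \<times> 'a) set) \<Rightarrow> ('a \<times> 'a) set" where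
  "representing_fraction h s =
    inv_into (carrier (sect (pre_struct R) (principal_open R h))) (to_struct_C R (principal_open R h))
      (restrict s (principal_open R h))"

context
  fixes h and U
  assumes h: "h \<in> carrier R" and U: "openin (zariski R) U" and sub: "principal_open R h \<subseteq> U"
begin

lemma representing_fraction_hom:
  "representing_fraction h \<in> semiring_hom (sect (struct_C R) U) (sect (pre_struct R) (principal_open R h))"
proof -
  interpret F: csemiring "sect (pre_struct R) (principal_open R h)"
    by (rule semiring_presheaf.csemiring_sect[OF semiring_presheaf_pre_struct openin_principal_open[OF h]])
  note hom = semiring_presheaf.restr_hom[OF semiring_sheaf.axioms(1)[OF semiring_sheaf_struct_C]
      U openin_principal_open[OF h] sub]
  show ?thesis
    using semiring_hom_comp[OF hom semiring_isoD(1)[OF F.semiring_iso_inverse[OF to_struct_C_iso[OF h]]]]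
    by (simp add: representing_fraction_def[abs_def] struct_C_restr)
qed

lemma to_struct_C_representing_fraction:
  assumes "s \<in> carrier (sect (struct_C R) U)"
  shows "to_struct_C R (principal_open R h) (representing_fraction h s) = restrict s (principal_open R h)"
proof -
  have "restrict s (principal_open R h) \<in> carrier (sect (struct_C R) (principal_open R h))"
    using semiring_presheaf.restr_closed[OF semiring_sheaf.axioms(1)[OF semiring_sheaf_struct_C]
        U openin_principal_open[OF h] sub assms]
    by (simp add: struct_C_restr)
  then show ?thesis
    unfolding representing_fraction_def using semiring_isoD(3)[OF to_struct_C_iso[OF h]]
    by (intro f_inv_into_f) metis
qed

end

lemma representing_fraction_unique:
  assumes "h \<in> carrier R" "x \<in> carrier (sect (pre_struct R) (principal_open R h))"
    and "to_struct_C R (principal_open R h) x = restrict s (principal_open R h)"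
  shows "representing_fraction h s = x"
  unfolding representing_fraction_def assms(3)[symmetric]
  using inv_into_f_f[OF to_struct_C_inj] assms by blast

lemma equalizer_sect:
  "equalizer_semiring R I a = subproduct I (\<lambda>i. sect (pre_struct R) (principal_open R (a i)))
     {s \<in> (\<Pi>\<^sub>E i\<in>I. carrier (sect (pre_struct R) (principal_open R (a i)))).
       \<forall>i\<in>I. \<forall>j\<in>I.
         restr (pre_struct R) (principal_open R (a i)) (principal_open R (a i \<otimes> a j)) (s i) =
         restr (pre_struct R) (principal_open R (a j)) (principal_open R (a i \<otimes> a j)) (s j)}"
  by (simp add: equalizer_semiring_def)

text \<open>A section over the union is determined by its restrictions to the \<open>D(a\<^sub>i)\<close>, each of which is
  one fraction. Conversely, compatible fractions have common values at each point of the union, and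
  these values are locally fractions.\<close>

lemma struct_C_equalizer_iso:
  assumes a: "a \<in> I \<rightarrow> carrier R"
  shows "(\<lambda>s. \<lambda>i\<in>I. representing_fraction (a i) s)
    \<in> semiring_iso (sect (struct_C R) (\<Union>i\<in>I. principal_open R (a i))) (equalizer_semiring R I a)"
proof -
  let ?D = "\<lambda>i. principal_open R (a i)"
  let ?U = "\<Union>i\<in>I. ?D i"
  let ?F = "\<lambda>i. sect (pre_struct R) (?D i)"
  have ai: "a i \<in> carrier R" if "i \<in> I" for i using a that by auto
  have oD: "openin (zariski R) (?D i)" if "i \<in> I" for i using ai[OF that] by (rule openin_principal_open)
  have U: "openin (zariski R) ?U" using oD by blast
  have sub: "?D i \<subseteq> ?U" if "i \<in> I" for i using that by blast
  have meet: "a i \<otimes> a j \<in> carrier R" "openin (zariski R) (principal_open R (a i \<otimes> a j))"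
    "principal_open R (a i \<otimes> a j) = ?D i \<inter> ?D j" if "i \<in> I" "j \<in> I" for i j
    using that ai by (simp, simp add: openin_principal_open, simp add: principal_open_mult)
  have rf: "representing_fraction (a i) s \<in> carrier (?F i)"
      "to_struct_C R (?D i) (representing_fraction (a i) s) = restrict s (?D i)"
    if "i \<in> I" "s \<in> carrier (sect (struct_C R) ?U)" for i s
    using semiring_homD(1)[OF representing_fraction_hom[OF ai U sub]]
      to_struct_C_representing_fraction[OF ai U sub] that by blast+
  have rf_restr: "restr (pre_struct R) (?D k) (principal_open R (a i \<otimes> a j)) (representing_fraction (a k) s) =
      representing_fraction (a i \<otimes> a j) s"
    if ij: "i \<in> I" "j \<in> I" "k = i \<or> k = j" and s: "s \<in> carrier (sect (struct_C R) ?U)" for i j k s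
  proof -
    have k: "k \<in> I" "principal_open R (a i \<otimes> a j) \<subseteq> ?D k" using ij meet by auto
    note r = oD[OF k(1)] meet(2)[OF ij(1,2)] k(2) rf(1)[OF k(1) s]
    show ?thesis
    proof (rule representing_fraction_unique[symmetric, OF meet(1)[OF ij(1,2)]])
      show "restr (pre_struct R) (?D k) (principal_open R (a i \<otimes> a j)) (representing_fraction (a k) s)
          \<in> carrier (sect (pre_struct R) (principal_open R (a i \<otimes> a j)))"
        by (rule semiring_presheaf.restr_closed[OF semiring_presheaf_pre_struct r])
      show "to_struct_C R (principal_open R (a i \<otimes> a j))
          (restr (pre_struct R) (?D k) (principal_open R (a i \<otimes> a j)) (representing_fraction (a k) s)) =
          restrict s (principal_open R (a i \<otimes> a j))"
        unfolding to_struct_C_restr[OF r] rf(2)[OF k(1) s] using k(2) by (simp add: Int_absorb1)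
    qed
  qed
  show ?thesis
  proof (rule semiring_isoI)
    show "(\<lambda>s. \<lambda>i\<in>I. representing_fraction (a i) s)
        \<in> semiring_hom (sect (struct_C R) ?U) (equalizer_semiring R I a)"
      unfolding equalizer_sect
    proof (rule semiring_hom_into_subproduct)
      show "representing_fraction (a i) \<in> semiring_hom (sect (struct_C R) ?U) (?F i)" if "i \<in> I" for i
        by (rule representing_fraction_hom[OF ai[OF that] U sub[OF that]])
    qed (use rf(1) rf_restr in auto)
    show "inj_on (\<lambda>s. \<lambda>i\<in>I. representing_fraction (a i) s) (carrier (sect (struct_C R) ?U))"
    proof (rule inj_onI)
      fix s t assume st: "s \<in> carrier (sect (struct_C R) ?U)" "t \<in> carrier (sect (struct_C R) ?U)"
        and eq: "(\<lambda>i\<in>I. representing_fraction (a i) s) = (\<lambda>i\<in>I. representing_fraction (a i) t)"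
      show "s = t"
      proof (rule struct_C_eqI[OF st])
        fix P assume "P \<in> ?U"
        then obtain i where i: "i \<in> I" "P \<in> ?D i" by blast
        then have "representing_fraction (a i) s = representing_fraction (a i) t"
          using fun_cong[OF eq, of i] by simp
        then have "restrict s (?D i) = restrict t (?D i)" using rf(2)[OF i(1)] st by metis
        then show "s P = t P" using i(2) by (metis restrict_apply')
      qed
    qed
    show "carrier (equalizer_semiring R I a) \<subseteq>
        (\<lambda>s. \<lambda>i\<in>I. representing_fraction (a i) s) ` carrier (sect (struct_C R) ?U)"
    proof
      fix x assume "x \<in> carrier (equalizer_semiring R I a)"
      then have x: "x \<in> (\<Pi>\<^sub>E i\<in>I. carrier (?F i))"
        and compat: "\<And>i j. i \<in> I \<Longrightarrow> j \<in> I \<Longrightarrow>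
          restr (pre_struct R) (?D i) (principal_open R (a i \<otimes> a j)) (x i) =
          restr (pre_struct R) (?D j) (principal_open R (a i \<otimes> a j)) (x j)"
        by (auto simp: equalizer_sect)
      have xi: "x i \<in> carrier (?F i)" if "i \<in> I" for i using x that by auto
      \<comment> \<open>by compatibility the value at \<open>P\<close> does not depend on the index that is chosen\<close>
      define idx where "idx P = (SOME i. i \<in> I \<and> P \<in> ?D i)" for P
      have idx: "idx P \<in> I" "P \<in> ?D (idx P)" if "P \<in> ?U" for P
        using that someI_ex[of "\<lambda>i. i \<in> I \<and> P \<in> ?D i"] by (auto simp: idx_def)
      define s where "s = (\<lambda>P\<in>?U. loc_map R (carrier R - P) (x (idx P)))"
      have s: "s P = loc_map R (carrier R - P) (x i)" if i: "i \<in> I" "P \<in> ?D i" for i P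
      proof -
        have P: "P \<in> ?U" "P \<in> Spec R" using i by (auto simp: principal_open_def)
        interpret F: stalk_model "zariski R" "pre_struct R" "loc_prime R P" P
          "\<lambda>U. loc_map R (carrier R - P)" by (rule stalk_model_pre_struct[OF P(2)])
        note j = idx[OF P(1)]
        let ?W = "principal_open R (a (idx P) \<otimes> a i)"
        have W: "openin (zariski R) ?W" "P \<in> ?W" "?W \<subseteq> ?D i" "?W \<subseteq> ?D (idx P)"
          using meet[OF j(1) i(1)] i j by auto
        have "loc_map R (carrier R - P) (x (idx P)) =
            loc_map R (carrier R - P) (restr (pre_struct R) (?D (idx P)) ?W (x (idx P)))"
          using F.ev_restr[OF oD[OF j(1)] W(1,2,4) xi[OF j(1)]] by simp
        also have "\<dots> = loc_map R (carrier R - P) (x i)"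
          unfolding compat[OF j(1) i(1)] by (rule F.ev_restr[OF oD[OF i(1)] W(1-3) xi[OF i(1)]])
        finally show ?thesis using P by (simp add: s_def)
      qed
      have sD: "restrict s (?D i) = to_struct_C R (?D i) (x i)" if "i \<in> I" for i
        unfolding to_struct_C_def using s[OF that] by (intro restrict_ext)
      have "locally_fraction ?U s"
      proof (rule locally_fraction_local)
        fix P assume "P \<in> ?U"
        then obtain i where i: "i \<in> I" "P \<in> ?D i" by blast
        have "to_struct_C R (?D i) (x i) \<in> carrier (sect (struct_C R) (?D i))"
          using semiring_homD(1)[OF to_struct_C_hom[OF oD[OF i(1)]] xi[OF i(1)]] .
        then have "locally_fraction (?D i) (restrict s (?D i))"
          unfolding sD[OF i(1)] by (simp add: struct_C_carrier)
        then have "locally_fraction (?D i) s" by (rule locally_fraction_cong) simp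
        then show "\<exists>V. openin (zariski R) V \<and> P \<in> V \<and> V \<subseteq> ?U \<and> locally_fraction V s"
          using i oD by blast
      qed
      then have sC: "s \<in> carrier (sect (struct_C R) ?U)"
        by (intro struct_C_I) (auto simp: s_def)
      have "x = (\<lambda>i\<in>I. representing_fraction (a i) s)"
      proof (rule PiE_ext[OF x])
        show "(\<lambda>i\<in>I. representing_fraction (a i) s) \<in> (\<Pi>\<^sub>E i\<in>I. carrier (?F i))"
          using rf(1) sC by auto
        show "x i = (\<lambda>i\<in>I. representing_fraction (a i) s) i" if "i \<in> I" for i
          using representing_fraction_unique[OF ai[OF that] xi[OF that] sD[OF that, symmetric]] that by simp
      qed
      then show "x \<in> (\<lambda>s. \<lambda>i\<in>I. representing_fraction (a i) s) ` carrier (sect (struct_C R) ?U)"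
        using sC by blast
    qed
  qed
qed

definition C_to_B where
  "C_to_B U s = (\<lambda>b\<in>principal_within R U. representing_fraction b s)"

lemma struct_B_sect: "sect (struct_B R) U = equalizer_semiring R (principal_within R U) (\<lambda>b. b)"
  by (simp add: struct_B_def)

text \<open>The case of the family of all principal open sets contained in \<open>U\<close>.\<close>

lemma C_to_B_iso: "presheaf_iso (zariski R) (struct_C R) (struct_B R) C_to_B"
  unfolding presheaf_iso_def
proof (intro conjI allI impI ballI)
  show "C_to_B U \<in> semiring_iso (sect (struct_C R) U) (sect (struct_B R) U)"
    if "openin (zariski R) U" for U
    using struct_C_equalizer_iso[of "\<lambda>b. b" "principal_within R U"] principal_within_cover[OF that]
    by (simp add: struct_B_sect C_to_B_def[abs_def] principal_within_def)
  fix U V s assume UV: "openin (zariski R) U \<and> openin (zariski R) V \<and> V \<subseteq> U"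
  have "representing_fraction b (restrict s V) = representing_fraction b s"
    if "b \<in> principal_within R V" for b
    using that by (simp add: representing_fraction_def principal_within_def Int_absorb1)
  moreover have "principal_within R V \<subseteq> principal_within R U"
    using UV by (auto simp: principal_within_def)
  ultimately show "restr (struct_B R) U V (C_to_B U s) = C_to_B V (restr (struct_C R) U V s)"
    by (auto simp: struct_B_def struct_C_restr C_to_B_def restrict_def fun_eq_iff)
qed

lemma C_to_B_to_struct_C:
  assumes U: "openin (zariski R) U" and x: "x \<in> carrier (sect (pre_struct R) U)"
  shows "C_to_B U (to_struct_C R U x) = to_struct_B R U x"
  unfolding C_to_B_def to_struct_B_def
proof (rule restrict_ext)
  fix b assume "b \<in> principal_within R U"
  then have b: "b \<in> carrier R" "principal_open R b \<subseteq> U" by (auto simp: principal_within_def)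
  note r = U openin_principal_open[OF b(1)] b(2) x
  show "representing_fraction b (to_struct_C R U x) = restr (pre_struct R) U (principal_open R b) x"
    using semiring_presheaf.restr_closed[OF semiring_presheaf_pre_struct r] to_struct_C_restr[OF r]
    by (intro representing_fraction_unique[OF b(1)])
qed

text \<open>Both sides are equalizers for a cover of the same open set, so both are identified with the
  sections of C over it; the composite of the two identifications is the projection.\<close>

lemma struct_B_equalizer_iso:
  assumes a: "a \<in> I \<rightarrow> carrier R"
  shows "(\<lambda>s. \<lambda>i\<in>I. s (a i))
    \<in> semiring_iso (sect (struct_B R) (\<Union>i\<in>I. principal_open R (a i))) (equalizer_semiring R I a)"
proof -
  let ?U = "\<Union>i\<in>I. principal_open R (a i)"
  have U: "openin (zariski R) ?U" using a openin_principal_open by blast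
  interpret C: semiring_sheaf "zariski R" "struct_C R" by (rule semiring_sheaf_struct_C)
  interpret B: csemiring "sect (struct_B R) ?U"
    using C.presheaf_transport[OF C_to_B_iso] U by (rule semiring_presheaf.csemiring_sect)
  show ?thesis
  proof (rule B.semiring_iso_cong)
    show "(\<lambda>t. \<lambda>i\<in>I. representing_fraction (a i)
          (inv_into (carrier (sect (struct_C R) ?U)) (C_to_B ?U) t))
        \<in> semiring_iso (sect (struct_B R) ?U) (equalizer_semiring R I a)"
      using semiring_iso_comp[OF presheaf_isoD(1)[OF C.presheaf_iso_inverse[OF C_to_B_iso] U]
          struct_C_equalizer_iso[OF a]] .
    fix t assume "t \<in> carrier (sect (struct_B R) ?U)"
    then obtain s where s: "s \<in> carrier (sect (struct_C R) ?U)" "t = C_to_B ?U s"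
      by (rule C.iso_rep[OF C_to_B_iso U])
    have "a i \<in> principal_within R ?U" if "i \<in> I" for i
      using a that by (auto simp: principal_within_def)
    then show "(\<lambda>i\<in>I. t (a i)) = (\<lambda>i\<in>I. representing_fraction (a i)
          (inv_into (carrier (sect (struct_C R) ?U)) (C_to_B ?U) t))"
      unfolding s(2) C.iso_inv[OF C_to_B_iso U s(1)] by (intro restrict_ext) (simp add: C_to_B_def)
  qed
qed


section \<open>The sheafification\<close>

text \<open>The isomorphism from \<open>A\<^sub>P\<close> to the stalk of the presheaf of fractions, sending \<open>a/f\<close> to its
  germ.\<close>

abbreviation fraction_germ :: "'a set \<Rightarrow> ('a \<times> 'a) set \<Rightarrow> ('a set set \<times> ('a \<times> 'a) set) set" where
  "fraction_germ P \<equiv>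
    stalk_model.germ_of_value (zariski R) (pre_struct R) P (\<lambda>U. loc_map R (carrier R - P))"

definition C_to_A where
  "C_to_A U s = (\<lambda>P\<in>U. fraction_germ P (s P))"

lemma fraction_germ_iso:
  "P \<in> Spec R \<Longrightarrow> fraction_germ P \<in> semiring_iso (loc_prime R P) (stalk (zariski R) (pre_struct R) P)"
  by (rule stalk_model.germ_of_value_iso[OF stalk_model_pre_struct])

lemma germ_eq_fraction_germ:
  assumes "openin (zariski R) U" "P \<in> U" "x \<in> carrier (sect (pre_struct R) U)"
  shows "germ (zariski R) (pre_struct R) P U x = fraction_germ P (to_struct_C R U x P)"
proof -
  have "P \<in> Spec R" using openin_subset_Spec assms by blast
  then show ?thesis
    using stalk_model.germ_eq[OF stalk_model_pre_struct assms] assms(2) by (simp add: to_struct_C_def)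
qed

lemma struct_A_sect:
  "sect (struct_A R) U = subproduct U (stalk (zariski R) (pre_struct R))
     {s \<in> (\<Pi>\<^sub>E P\<in>U. carrier (stalk (zariski R) (pre_struct R) P)).
       \<forall>P\<in>U. \<exists>V t. openin (zariski R) V \<and> P \<in> V \<and> V \<subseteq> U \<and> t \<in> carrier (sect (pre_struct R) V) \<and>
         (\<forall>Q\<in>V. s Q = germ (zariski R) (pre_struct R) Q V t)}"
  by (simp add: struct_A_def sheafification_def)

text \<open>Pointwise application of \<open>fraction_germ\<close>. A section of the presheaf over \<open>V\<close> is a fraction whose
  denominator vanishes nowhere on \<open>V\<close>, so the local conditions on both sides correspond.\<close>

lemma C_to_A_iso: "presheaf_iso (zariski R) (struct_C R) (struct_A R) C_to_A"
  unfolding presheaf_iso_def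
proof (intro conjI allI impI ballI)
  fix U assume U: "openin (zariski R) U"
  have Spec: "P \<in> Spec R" if "P \<in> U" for P using openin_subset_Spec[OF U] that by blast
  note G = semiring_homD(1)[OF semiring_isoD(1)[OF fraction_germ_iso]]
    semiring_isoD(2,3)[OF fraction_germ_iso]
  have val: "s P \<in> carrier (loc_prime R P)" if "s \<in> carrier (sect (struct_C R) U)" "P \<in> U" for s P
    using that by (auto simp: struct_C_carrier)
  show "C_to_A U \<in> semiring_iso (sect (struct_C R) U) (sect (struct_A R) U)"
  proof (rule semiring_isoI)
    show "C_to_A U \<in> semiring_hom (sect (struct_C R) U) (sect (struct_A R) U)"
      unfolding C_to_A_def[abs_def] struct_A_sect
    proof (rule semiring_hom_into_subproduct)
      show "(\<lambda>s. fraction_germ P (s P))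
          \<in> semiring_hom (sect (struct_C R) U) (stalk (zariski R) (pre_struct R) P)" if "P \<in> U" for P
        using semiring_hom_comp[OF struct_C_ev_hom semiring_isoD(1)[OF fraction_germ_iso]] that Spec
        by blast
      fix s assume s: "s \<in> carrier (sect (struct_C R) U)"
      have "\<exists>V t. openin (zariski R) V \<and> P \<in> V \<and> V \<subseteq> U \<and> t \<in> carrier (sect (pre_struct R) V) \<and>
          (\<forall>Q\<in>V. (\<lambda>P\<in>U. fraction_germ P (s P)) Q = germ (zariski R) (pre_struct R) Q V t)"
        if P: "P \<in> U" for P
      proof -
        obtain V a f where V: "openin (zariski R) V" "P \<in> V" "V \<subseteq> U" "a \<in> carrier R" "f \<in> carrier R"
          "\<forall>Q\<in>V. f \<notin> Q \<and> s Q = fraction R (carrier R - Q) a f"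
          by (rule locally_fractionE[of U s P]) (use s P in \<open>auto simp: struct_C_carrier\<close>)
        have f: "f \<in> denom R V"
          using V openin_subset_Spec[OF V(1)] by (auto simp: denom_def principal_open_def)
        let ?t = "fraction R (denom R V) a f"
        have t: "?t \<in> carrier (sect (pre_struct R) V)" using V f by (auto simp: pre_struct_carrier)
        have "(\<lambda>P\<in>U. fraction_germ P (s P)) Q = germ (zariski R) (pre_struct R) Q V ?t"
          if Q: "Q \<in> V" for Q
        proof -
          have "to_struct_C R V ?t Q = s Q" using to_struct_C_fraction[OF V(1) Q V(4) f] V(6) Q by simp
          then show ?thesis using germ_eq_fraction_germ[OF V(1) Q t] Q V(3) by auto
        qed
        then show ?thesis using V t by blast
      qed
      then show "(\<lambda>P\<in>U. fraction_germ P (s P))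
          \<in> {s \<in> \<Pi>\<^sub>E P\<in>U. carrier (stalk (zariski R) (pre_struct R) P).
             \<forall>P\<in>U. \<exists>V t. openin (zariski R) V \<and> P \<in> V \<and> V \<subseteq> U \<and>
               t \<in> carrier (sect (pre_struct R) V) \<and>
               (\<forall>Q\<in>V. s Q = germ (zariski R) (pre_struct R) Q V t)}"
        using G(1)[OF Spec] val[OF s] by simp
    qed
    show "inj_on (C_to_A U) (carrier (sect (struct_C R) U))"
    proof (rule inj_onI)
      fix s t assume st: "s \<in> carrier (sect (struct_C R) U)" "t \<in> carrier (sect (struct_C R) U)"
        and eq: "C_to_A U s = C_to_A U t"
      show "s = t"
      proof (rule struct_C_eqI[OF st])
        fix P assume P: "P \<in> U"
        have "fraction_germ P (s P) = fraction_germ P (t P)"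
          using fun_cong[OF eq, of P] P by (simp add: C_to_A_def)
        then show "s P = t P"
          using inj_onD[OF G(2)[OF Spec[OF P]]] val[OF st(1) P] val[OF st(2) P] by blast
      qed
    qed
    show "carrier (sect (struct_A R) U) \<subseteq> C_to_A U ` carrier (sect (struct_C R) U)"
    proof
      fix x assume "x \<in> carrier (sect (struct_A R) U)"
      then have x: "x \<in> (\<Pi>\<^sub>E P\<in>U. carrier (stalk (zariski R) (pre_struct R) P))"
        and loc: "\<forall>P\<in>U. \<exists>V t. openin (zariski R) V \<and> P \<in> V \<and> V \<subseteq> U \<and>
          t \<in> carrier (sect (pre_struct R) V) \<and>
          (\<forall>Q\<in>V. x Q = germ (zariski R) (pre_struct R) Q V t)"
        by (simp_all add: struct_A_sect)
      define s where "s = (\<lambda>P\<in>U. inv_into (carrier (loc_prime R P)) (fraction_germ P) (x P))"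
      have "locally_fraction U s"
      proof (rule locally_fraction_local)
        fix P assume "P \<in> U"
        then obtain V t where V: "openin (zariski R) V" "P \<in> V" "V \<subseteq> U"
          and t: "t \<in> carrier (sect (pre_struct R) V)"
          and eq: "\<forall>Q\<in>V. x Q = germ (zariski R) (pre_struct R) Q V t" using loc by metis
        have C: "to_struct_C R V t \<in> carrier (sect (struct_C R) V)"
          using semiring_homD(1)[OF to_struct_C_hom[OF V(1)] t] .
        have "s Q = to_struct_C R V t Q" if Q: "Q \<in> V" for Q
        proof -
          have "x Q = fraction_germ Q (to_struct_C R V t Q)"
            using eq Q germ_eq_fraction_germ[OF V(1) Q t] by simp
          moreover have "to_struct_C R V t Q \<in> carrier (loc_prime R Q)"
            using C Q by (auto simp: struct_C_carrier)
          moreover have "Q \<in> U" using V Q by blast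
          ultimately show ?thesis using inv_into_f_f[OF G(2)[OF Spec]] by (simp add: s_def)
        qed
        then have "locally_fraction V s"
          using C locally_fraction_cong[of V "to_struct_C R V t" s] by (simp add: struct_C_carrier)
        then show "\<exists>V. openin (zariski R) V \<and> P \<in> V \<and> V \<subseteq> U \<and> locally_fraction V s"
          using V by blast
      qed
      then have "s \<in> carrier (sect (struct_C R) U)" by (intro struct_C_I) (auto simp: s_def)
      moreover have "x = C_to_A U s"
      proof
        fix P show "x P = C_to_A U s P"
        proof (cases "P \<in> U")
          case True
          then have "x P \<in> fraction_germ P ` carrier (loc_prime R P)"
            using x G(3)[OF Spec[OF True]] by auto
          then show ?thesis using True by (simp add: C_to_A_def s_def f_inv_into_f)
        next
          case False
          then show ?thesis using x by (auto simp: C_to_A_def PiE_def extensional_def)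
        qed
      qed
      ultimately show "x \<in> C_to_A U ` carrier (sect (struct_C R) U)" by blast
    qed
  qed
next
  fix U V s assume "openin (zariski R) U \<and> openin (zariski R) V \<and> V \<subseteq> U"
  then show "restr (struct_A R) U V (C_to_A U s) = C_to_A V (restr (struct_C R) U V s)"
    by (auto simp: struct_A_def sheafification_def struct_C_restr C_to_A_def restrict_def fun_eq_iff)
qed

lemma C_to_A_to_struct_C:
  assumes U: "openin (zariski R) U" and x: "x \<in> carrier (sect (pre_struct R) U)"
  shows "C_to_A U (to_struct_C R U x) = to_sheafification (zariski R) (pre_struct R) U x"
  unfolding C_to_A_def to_sheafification_def
  using germ_eq_fraction_germ[OF U _ x] by (intro restrict_ext) simp


section \<open>Comparison of the three structure sheaves\<close>

lemma iso_loc_elem_one: "(\<lambda>x. fraction R {\<one> [^] n | n::nat. True} x \<one>) \<in> semiring_iso R (loc_elem R \<one>)"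
proof -
  have one: "{\<one> [^] n | n::nat. True} = {\<one>}" by auto
  have S: "submonoid {\<one>} R" by unfold_locales auto
  have "(\<lambda>x. fraction R {\<one>} x \<one>) \<in> semiring_iso R (localization R {\<one>})"
  proof (rule semiring_isoI)
    show "(\<lambda>x. fraction R {\<one>} x \<one>) \<in> semiring_hom R (localization R {\<one>})"
      by (rule semiring_homI) (auto simp: localization_simps fraction_mult[OF S] fraction_add[OF S])
    show "inj_on (\<lambda>x. fraction R {\<one>} x \<one>) (carrier R)"
      by (auto simp: inj_on_def fraction_eq_iff[OF S])
  qed (auto simp: localization_simps)
  then show ?thesis unfolding loc_elem_def one .
qed

text \<open>The assertions about sections and stalks hold for any sheaf isomorphic to C; they are applied to A,
  to B and to C itself.\<close>

context
  fixes F :: "('a set, 'c) presheaf" and \<phi>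
  assumes iso: "presheaf_iso (zariski R) (struct_C R) F \<phi>"
begin

lemma model_semiring_sheaf: "semiring_sheaf (zariski R) F"
  using semiring_sheaf.sheaf_transport[OF semiring_sheaf_struct_C iso] .

lemma model_principal_open_iso:
  "a \<in> carrier R \<Longrightarrow> (\<lambda>x. \<phi> (principal_open R a) (to_struct_C R (principal_open R a) x))
    \<in> semiring_iso (sect (pre_struct R) (principal_open R a)) (sect F (principal_open R a))"
  using semiring_iso_comp[OF to_struct_C_iso presheaf_isoD(1)[OF iso openin_principal_open]] .

lemma model_natural_iso:
  "a \<in> carrier R \<Longrightarrow> (\<lambda>x. \<phi> (principal_open R a) (to_struct_C R (principal_open R a)
      (loc_map R (denom R (principal_open R a)) x)))
    \<in> semiring_iso (loc_elem R a) (sect F (principal_open R a))"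
  using semiring_iso_comp[OF loc_elem_iso_pre_struct model_principal_open_iso] .

lemma model_global_sections: "semiring_isomorphic (sect F (Spec R)) R"
  using semiring_isomorphic_sym semiring_iso_comp[OF iso_loc_elem_one model_natural_iso[OF closed_ops(4)]]
  unfolding semiring_isomorphic_def principal_open_one by blast

lemma model_stalk:
  "P \<in> Spec R \<Longrightarrow> semiring_isomorphic (stalk (zariski R) F P) (loc_prime R P)"
  using stalk_model.stalk_isomorphic[OF stalk_model.stalk_model_transport[OF stalk_model_struct_C iso]] .

end

lemma C_to_C_iso: "presheaf_iso (zariski R) (struct_C R) (struct_C R) (\<lambda>U s. s)"
  by (auto simp: presheaf_iso_def semiring_iso_def semiring_hom_def ring_hom_def bij_betw_def)

lemma presheaf_isomorphic_A_B: "presheaf_isomorphic (zariski R) (struct_A R) (struct_B R)"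
  using presheaf_iso_comp[OF semiring_presheaf.presheaf_iso_inverse[OF
      semiring_sheaf.axioms(1)[OF semiring_sheaf_struct_C] C_to_A_iso] C_to_B_iso]
  unfolding presheaf_isomorphic_iff by blast

lemma presheaf_isomorphic_B_C: "presheaf_isomorphic (zariski R) (struct_B R) (struct_C R)"
  using semiring_presheaf.presheaf_iso_inverse[OF
      semiring_sheaf.axioms(1)[OF semiring_sheaf_struct_C] C_to_B_iso]
  unfolding presheaf_isomorphic_iff by blast

lemma to_struct_B_iso:
  assumes a: "a \<in> carrier R"
  shows "to_struct_B R (principal_open R a)
    \<in> semiring_iso (sect (pre_struct R) (principal_open R a)) (sect (struct_B R) (principal_open R a))"
proof (rule csemiring.semiring_iso_cong[OF _ model_principal_open_iso[OF C_to_B_iso a]])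
  note U = openin_principal_open[OF a]
  show "csemiring (sect (pre_struct R) (principal_open R a))"
    by (rule semiring_presheaf.csemiring_sect[OF semiring_presheaf_pre_struct U])
qed (simp add: C_to_B_to_struct_C openin_principal_open[OF a])

text \<open>The isomorphisms of C with A and with B are compatible with the natural maps from the presheaf, so
  the isomorphisms found for an arbitrary model are the natural ones.\<close>

lemma natural_isos:
  assumes a: "a \<in> carrier R"
  shows "natural_A R a \<in> semiring_iso (loc_elem R a) (sect (struct_A R) (principal_open R a))"
    and "natural_B R a \<in> semiring_iso (loc_elem R a) (sect (struct_B R) (principal_open R a))"
    and "natural_C R a \<in> semiring_iso (loc_elem R a) (sect (struct_C R) (principal_open R a))"
proof -
  note U = openin_principal_open[OF a]
  interpret L: csemiring "loc_elem R a"
    unfolding loc_elem_def by (rule csemiring_localization[OF submonoid_powers[OF a]])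
  note x = semiring_homD(1)[OF semiring_isoD(1)[OF loc_elem_iso_pre_struct[OF a]]]
  show "natural_A R a \<in> semiring_iso (loc_elem R a) (sect (struct_A R) (principal_open R a))"
    by (rule L.semiring_iso_cong[OF model_natural_iso[OF C_to_A_iso a]])
      (simp add: natural_A_def C_to_A_to_struct_C[OF U x])
  show "natural_B R a \<in> semiring_iso (loc_elem R a) (sect (struct_B R) (principal_open R a))"
    by (rule L.semiring_iso_cong[OF model_natural_iso[OF C_to_B_iso a]])
      (simp add: natural_B_def C_to_B_to_struct_C[OF U x])
  show "natural_C R a \<in> semiring_iso (loc_elem R a) (sect (struct_C R) (principal_open R a))"
    by (rule L.semiring_iso_cong[OF model_natural_iso[OF C_to_C_iso a]])
      (simp add: natural_C_def)
qed

end

theorem theorem3p18: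
  fixes A :: "('a, 'm) ring_scheme"
  assumes "csemiring A"
  shows
    "(semiring_sheaf (zariski A) (struct_A A) \<and>
      semiring_sheaf (zariski A) (struct_B A) \<and>
      semiring_sheaf (zariski A) (struct_C A)) \<and>
     ((\<forall>a\<in>carrier A. to_struct_B A (principal_open A a)
          \<in> semiring_iso (sect (pre_struct A) (principal_open A a))
                          (sect (struct_B A) (principal_open A a))) \<and>
      (\<forall>(I :: 'i set) (a :: 'i \<Rightarrow> 'a). a \<in> I \<rightarrow> carrier A \<longrightarrow>
          (\<lambda>s. \<lambda>i\<in>I. s (a i))
            \<in> semiring_iso (sect (struct_B A) (\<Union>i\<in>I. principal_open A (a i)))
                            (equalizer_semiring A I a))) \<and>
     (presheaf_isomorphic (zariski A) (struct_A A) (struct_B A) \<and>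
      presheaf_isomorphic (zariski A) (struct_B A) (struct_C A)) \<and>
     (\<forall>a\<in>carrier A.
        natural_A A a \<in> semiring_iso (loc_elem A a) (sect (struct_A A) (principal_open A a)) \<and>
        natural_B A a \<in> semiring_iso (loc_elem A a) (sect (struct_B A) (principal_open A a)) \<and>
        natural_C A a \<in> semiring_iso (loc_elem A a) (sect (struct_C A) (principal_open A a))) \<and>
     (semiring_isomorphic (sect (struct_A A) (Spec A)) A \<and>
      semiring_isomorphic (sect (struct_B A) (Spec A)) A \<and>
      semiring_isomorphic (sect (struct_C A) (Spec A)) A) \<and>
     (\<forall>P\<in>Spec A. local_semiring (loc_prime A P) \<and>
        semiring_isomorphic (stalk (zariski A) (struct_A A) P) (loc_prime A P) \<and>
        semiring_isomorphic (stalk (zariski A) (struct_B A) P) (loc_prime A P) \<and>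
        semiring_isomorphic (stalk (zariski A) (struct_C A) P) (loc_prime A P))"
proof -
  interpret csemiring A by (rule assms)
  show ?thesis
    using model_semiring_sheaf[OF C_to_A_iso] model_semiring_sheaf[OF C_to_B_iso] semiring_sheaf_struct_C
      to_struct_B_iso struct_B_equalizer_iso presheaf_isomorphic_A_B presheaf_isomorphic_B_C natural_isos
      model_global_sections[OF C_to_A_iso] model_global_sections[OF C_to_B_iso]
      model_global_sections[OF C_to_C_iso] local_semiring_loc_prime
      model_stalk[OF C_to_A_iso] model_stalk[OF C_to_B_iso] model_stalk[OF C_to_C_iso]
    by (intro conjI allI impI ballI) assumption+
qed

end
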